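(* For all $a,b,c\in2\mathbb N$ and every integer $n\ge2$, $$\Phi_n\begin{pmatrix}a&c\\ b&0\end{pmatrix}=\frac{(n-1)!!}{(n-2)!!}\cdot\frac{(a+c+n-2)!!\,(b+c+n-2)!!}{(c+n-2)!!\,(a+b+c+n-1)!!}.$$
   Context: Double factorial convention (non-standard): for an integer $m\ge0$, $m!!=(m-1)(m-3)\cdots$, the product of the positive integers $\le m-1$ of the parity of $m-1$ (empty product $=1$). For a $2\times q$ matrix with nonnegative integer entries and $n\ge\max(2,q)$, $I_n\begin{pmatrix}{\bf a}\\{\bf b}\end{pmatrix}=\int_{O_n}\prod_j u_{1j}^{a_j}u_{2j}^{b_j}\,du$ (Haar probability measure on $O_n$) and $\Phi_n\begin{pmatrix}{\bf a}\\ {\bf b}\end{pmatrix}=\frac{(\Sigma a_i+n-2)!!\,(\Sigma b_i+n-2)!!}{(n-2)!!^2\,\prod a_i!!\,\prod b_i!!}\,I_n\begin{pmatrix}{\bf a}\\ {\bf b}\end{pmatrix}$. *)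

theory Defs
  imports "HOL-Probability.Probability"
begin

text \<open>Non-standard double factorial of the paper: for m \<ge> 0,
  m!! = (m-1)(m-3)..., the product of the positive integers \<le> m-1 having
  the parity of m-1 (empty product = 1).\<close>
definition dfact :: "nat \<Rightarrow> real" where
  "dfact m = real (\<Prod>{k::nat. 1 \<le> k \<and> k + 1 \<le> m \<and> even (m - 1 - k)})"

definition mat_space :: "nat \<Rightarrow> (nat \<times> nat \<Rightarrow> real) measure" where
  "mat_space n = PiM ({..<n} \<times> {..<n}) (\<lambda>_. borel)"

definition orth_mats :: "nat \<Rightarrow> (nat \<times> nat \<Rightarrow> real) set" where
  "orth_mats n = {U \<in> space (mat_space n).
      \<forall>i<n. \<forall>j<n. (\<Sum>k<n. U (i, k) * U (j, k)) = (if i = j then 1 else 0)}"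

definition mat_mult :: "nat \<Rightarrow> (nat \<times> nat \<Rightarrow> real) \<Rightarrow> (nat \<times> nat \<Rightarrow> real) \<Rightarrow> (nat \<times> nat \<Rightarrow> real)" where
  "mat_mult n Q U = restrict (\<lambda>(i, j). \<Sum>k<n. Q (i, k) * U (k, j)) ({..<n} \<times> {..<n})"

text \<open>Haar probability measure on O_n: a (left-)invariant probability measure
  concentrated on the orthogonal group (unique by uniqueness of Haar measure).\<close>
definition is_haar_On :: "nat \<Rightarrow> (nat \<times> nat \<Rightarrow> real) measure \<Rightarrow> bool" where
  "is_haar_On n M \<longleftrightarrow> sets M = sets (mat_space n) \<and> prob_space M \<and>
     emeasure M (orth_mats n) = 1 \<and>
     (\<forall>Q \<in> orth_mats n. distr M (mat_space n) (mat_mult n Q) = M)"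

definition haar_On :: "nat \<Rightarrow> (nat \<times> nat \<Rightarrow> real) measure" where
  "haar_On n = (SOME M. is_haar_On n M)"

text \<open>I_n(a;b) for a 2\<times>q matrix with rows a, b (lists of length q);
  row 1 / row 2 of the paper are rows 0 / 1 here, column j is column j-1.\<close>
definition I_n :: "nat \<Rightarrow> nat list \<Rightarrow> nat list \<Rightarrow> real" where
  "I_n n a b = (\<integral>U. (\<Prod>j<length a. U (0, j) ^ (a ! j) * U (1, j) ^ (b ! j)) \<partial>haar_On n)"

definition Phi_n :: "nat \<Rightarrow> nat list \<Rightarrow> nat list \<Rightarrow> real" where
  "Phi_n n a b =
     dfact (sum_list a + n - 2) * dfact (sum_list b + n - 2) /
     (dfact (n - 2) ^ 2 * (\<Prod>j<length a. dfact (a ! j)) * (\<Prod>j<length b. dfact (b ! j)))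
     * I_n n a b"

end

theory Submission
  imports Defs "Jordan_Normal_Form.Determinant"
begin

text \<open>
  Write \<open>x\<close>, \<open>y\<close> for the first two columns of a Haar-distributed orthogonal matrix and
  \<open>F(a,b,c) = E[x\<^sub>0\<^sup>a x\<^sub>1\<^sup>b y\<^sub>0\<^sup>c]\<close>. Left invariance under the rotations of rows \<open>i\<close> and \<open>j\<close>,
  differentiated at the identity, says that the vector field \<open>u\<^sub>i \<partial>/\<partial>u\<^sub>j - u\<^sub>j \<partial>/\<partial>u\<^sub>i\<close> maps every
  polynomial to one of mean zero. Applying this to \<open>x\<^sub>0\<^sup>a\<^sup>+\<^sup>1 x\<^sub>1\<^sup>b y\<^sub>0\<^sup>c x\<^sub>k\<close> and summing over \<open>k \<noteq> 0\<close> with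
  \<open>|x| = 1\<close> and \<open>x \<bullet> y = 0\<close> gives \<open>(a+b+c+n) F(a+2,b,c) = (a+1) F(a,b,c)\<close>. In the same way
  \<open>(n+b-1) F(0,b+2,c) = (b+1) (F(0,b,c) - F(2,b,c))\<close> and \<open>(c+n) F(0,0,c+2) = (c+1) F(0,0,c)\<close>, and
  these recurrences determine all even moments.

  The Haar measure is introduced by a choice operator, so its existence is needed. It is the law of
  the Gram-Schmidt orthonormalisation of a random matrix: Lebesgue measure on matrices is invariant
  under left multiplication by orthogonal matrices, and Gram-Schmidt on columns commutes with it.
\<close>

section \<open>Isometry invariance of product Lebesgue measure\<close>

text \<open>Boxes determine the product measure, and on each factor an affine map of slope
  \<open>s\<close> scales lengths by \<open>\<bar>s\<bar> = 1\<close>. The case \<open>s = 1\<close>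
  is a translation and \<open>s = -1\<close> a point reflection; these are the two substitutions in
  the Fubini argument for isometries.\<close>

lemma distr_PiM_lborel_affine:
  fixes v :: "'i \<Rightarrow> real"
  assumes "finite I" "\<bar>s\<bar> = 1"
  shows "distr (PiM I (\<lambda>_. lborel)) (PiM I (\<lambda>_. lborel)) (\<lambda>x. \<lambda>i\<in>I. v i + s * x i) = PiM I (\<lambda>_. lborel)"
    (is "distr ?L ?L ?f = ?L")
proof -
  interpret product_sigma_finite "\<lambda>_::'i. lborel :: real measure" by standard
  have f [measurable]: "?f \<in> measurable ?L ?L" by measurable
  have one: "emeasure lborel ((\<lambda>t. w + s * t) -` B) = emeasure lborel B"
    if "B \<in> sets borel" for w and B :: "real set"
  proof -
    have "lborel = distr lborel borel (\<lambda>t. w + s * t)"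
      using lborel_real_affine[of s w] assms(2) by (auto simp: density_1)
    then have "emeasure lborel B = emeasure (distr lborel borel (\<lambda>t. w + s * t)) B" by simp
    with that show ?thesis by (simp add: emeasure_distr)
  qed
  show ?thesis
  proof (rule PiM_eqI)
    fix A :: "'i \<Rightarrow> real set"
    assume A: "\<And>i. i \<in> I \<Longrightarrow> A i \<in> sets lborel"
    have pre: "(\<lambda>t. v i + s * t) -` A i \<in> sets lborel" if "i \<in> I" for i
      using measurable_sets[of "\<lambda>t. v i + s * t" borel borel "A i"] A[OF that] by simp
    have "?f -` Pi\<^sub>E I A \<inter> space ?L = Pi\<^sub>E I (\<lambda>i. (\<lambda>t. v i + s * t) -` A i)"
      by (auto simp: space_PiM PiE_iff)
    moreover have "Pi\<^sub>E I A \<in> sets ?L" using assms(1) A by (intro sets_PiM_I_finite) auto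
    ultimately have "emeasure (distr ?L ?L ?f) (Pi\<^sub>E I A) =
        emeasure ?L (Pi\<^sub>E I (\<lambda>i. (\<lambda>t. v i + s * t) -` A i))"
      by (simp add: emeasure_distr)
    also have "\<dots> = (\<Prod>i\<in>I. emeasure lborel ((\<lambda>t. v i + s * t) -` A i))"
      using assms(1) pre by (intro emeasure_PiM) auto
    also have "\<dots> = (\<Prod>i\<in>I. emeasure lborel (A i))"
      using A by (intro prod.cong refl one) auto
    finally show "emeasure (distr ?L ?L ?f) (Pi\<^sub>E I A) = (\<Prod>i\<in>I. emeasure lborel (A i))" .
  qed (use assms in auto)
qed

lemma nn_integral_PiM_lborel_affine:
  fixes v :: "'i \<Rightarrow> real"
  assumes "finite I" "\<bar>s\<bar> = 1" and [measurable]: "f \<in> borel_measurable (PiM I (\<lambda>_. lborel))"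
  shows "(\<integral>\<^sup>+x. f (\<lambda>i\<in>I. v i + s * x i) \<partial>PiM I (\<lambda>_. lborel)) = (\<integral>\<^sup>+x. f x \<partial>PiM I (\<lambda>_. lborel))"
proof -
  have "(\<integral>\<^sup>+x. f x \<partial>PiM I (\<lambda>_. lborel)) =
      (\<integral>\<^sup>+x. f x \<partial>distr (PiM I (\<lambda>_. lborel)) (PiM I (\<lambda>_. lborel)) (\<lambda>x. \<lambda>i\<in>I. v i + s * x i))"
    using assms by (simp add: distr_PiM_lborel_affine)
  also have "\<dots> = (\<integral>\<^sup>+x. f (\<lambda>i\<in>I. v i + s * x i) \<partial>PiM I (\<lambda>_. lborel))"
    by (rule nn_integral_distr) measurable
  finally show ?thesis ..
qed

lemma emeasure_PiM_lborel_ball_finite: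
  fixes I :: "'i set"
  assumes "finite I"
  shows "emeasure (PiM I (\<lambda>_. lborel :: real measure)) {x \<in> space (PiM I (\<lambda>_. lborel)). (\<Sum>i\<in>I. (x i)\<^sup>2) \<le> R} < \<infinity>"
    (is "emeasure ?L ?B < \<infinity>")
proof -
  interpret product_sigma_finite "\<lambda>_::'i. lborel :: real measure" by standard
  have "emeasure ?L ?B \<le> emeasure ?L (Pi\<^sub>E I (\<lambda>_. {- sqrt R .. sqrt R}))"
  proof (rule emeasure_mono)
    show "?B \<subseteq> Pi\<^sub>E I (\<lambda>_. {- sqrt R .. sqrt R})"
    proof
      fix x assume x: "x \<in> ?B"
      have "\<bar>x i\<bar> \<le> sqrt R" if "i \<in> I" for i
      proof -
        have "(x i)\<^sup>2 \<le> (\<Sum>i\<in>I. (x i)\<^sup>2)" using that assms by (intro member_le_sum) auto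
        then have "(x i)\<^sup>2 \<le> R" using x by simp
        then show ?thesis by (simp add: real_le_rsqrt)
      qed
      then show "x \<in> Pi\<^sub>E I (\<lambda>_. {- sqrt R .. sqrt R})"
        using x by (force simp: space_PiM PiE_iff abs_le_iff)
    qed
  qed (use assms in \<open>auto intro!: sets_PiM_I_finite\<close>)
  also have "\<dots> = (\<Prod>i\<in>I. emeasure lborel {- sqrt R .. sqrt R})"
    using assms by (intro emeasure_PiM) auto
  also have "\<dots> < \<infinity>"
    by (auto simp: less_top[symmetric] power_eq_top_ennreal emeasure_lborel_Icc_eq)
  finally show ?thesis .
qed

text \<open>The squared radius \<open>card I\<close> is just large enough for the ball to contain
  the unit cube, which has volume 1.\<close>

lemma emeasure_PiM_lborel_ball_pos:
  fixes I :: "'i set"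
  assumes "finite I"
  shows "emeasure (PiM I (\<lambda>_. lborel :: real measure)) {x \<in> space (PiM I (\<lambda>_. lborel)). (\<Sum>i\<in>I. (x i)\<^sup>2) \<le> card I} > 0"
    (is "emeasure ?L ?B > 0")
proof -
  interpret product_sigma_finite "\<lambda>_::'i. lborel :: real measure" by standard
  have "(1::ennreal) = (\<Prod>i\<in>I. emeasure lborel {0..1::real})" by simp
  also have "\<dots> = emeasure ?L (Pi\<^sub>E I (\<lambda>_. {0..1}))"
    using assms by (intro emeasure_PiM[symmetric]) auto
  also have "\<dots> \<le> emeasure ?L ?B"
  proof (rule emeasure_mono)
    show "Pi\<^sub>E I (\<lambda>_. {0..1}) \<subseteq> ?B"
    proof
      fix x assume x: "x \<in> Pi\<^sub>E I (\<lambda>_. {0..1::real})"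
      have "(\<Sum>i\<in>I. (x i)\<^sup>2) \<le> (\<Sum>i\<in>I. 1)"
        using x by (intro sum_mono power_le_one) auto
      then show "x \<in> ?B" using x by (auto simp: space_PiM PiE_iff)
    qed
  qed measurable
  finally show ?thesis by (auto simp: zero_less_iff_neq_zero)
qed

text \<open>Both \<open>L\<close> and its image under \<open>T\<close> are translation invariant, so a Fubini argument shows
  that they are proportional; the ball, preserved by \<open>T\<close>, fixes the constant.\<close>
lemma distr_PiM_lborel_isometry:
  fixes T :: "('i \<Rightarrow> real) \<Rightarrow> ('i \<Rightarrow> real)" and I :: "'i set"
  defines "L \<equiv> PiM I (\<lambda>_. lborel)"
  assumes fin: "finite I" and T [measurable]: "T \<in> measurable L L"
    and sub: "\<And>x y. x \<in> space L \<Longrightarrow> y \<in> space L \<Longrightarrow> T (\<lambda>i\<in>I. x i - y i) = (\<lambda>i\<in>I. T x i - T y i)"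
    and surj: "\<And>y. y \<in> space L \<Longrightarrow> \<exists>x\<in>space L. T x = y"
    and isom: "\<And>x. x \<in> space L \<Longrightarrow> (\<Sum>i\<in>I. (T x i)\<^sup>2) = (\<Sum>i\<in>I. (x i)\<^sup>2)"
  shows "distr L L T = L"
proof -
  interpret product_sigma_finite "\<lambda>_::'i. lborel :: real measure" by standard
  interpret sigma_finite_measure L unfolding L_def by (rule sigma_finite[OF fin])
  interpret pair_sigma_finite L L by standard
  note affine = nn_integral_PiM_lborel_affine[OF fin, folded L_def]
  have minus [measurable]: "(\<lambda>z. \<lambda>i\<in>I. fst z i - snd z i) \<in> measurable (L \<Otimes>\<^sub>M L) L"
    and plus [measurable]: "(\<lambda>z. \<lambda>i\<in>I. fst z i + snd z i) \<in> measurable (L \<Otimes>\<^sub>M L) L"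
    unfolding L_def by measurable
  have T_sp: "T x \<in> space L" if "x \<in> space L" for x using that measurable_space[OF T] by blast
  \<comment> \<open>Both sides evaluate the double integral of \<open>f (T x) * g (T x + y)\<close>.
    Integrating over \<open>y\<close> first removes the shift by \<open>T x\<close> and gives the
    left side. Integrating over \<open>x\<close> first, the shift of \<open>x\<close> by
    \<open>w\<close> with \<open>T w = y\<close> turns the integrand into
    \<open>f (T x - y) * g (T x)\<close>; the reflection of \<open>y\<close> about
    \<open>T x\<close> then splits off the integral of \<open>f\<close>.\<close>
  have proportional: "(\<integral>\<^sup>+x. f (T x) \<partial>L) * (\<integral>\<^sup>+x. g x \<partial>L) = (\<integral>\<^sup>+x. g (T x) \<partial>L) * (\<integral>\<^sup>+x. f x \<partial>L)"
    if [measurable]: "f \<in> borel_measurable L" "g \<in> borel_measurable L" for f g :: "_ \<Rightarrow> ennreal"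
  proof -
    have m1: "(\<lambda>(x, y). f (T x) * g (\<lambda>i\<in>I. T x i + y i)) \<in> borel_measurable (L \<Otimes>\<^sub>M L)"
    proof -
      have "(\<lambda>z. (T (fst z), snd z)) \<in> measurable (L \<Otimes>\<^sub>M L) (L \<Otimes>\<^sub>M L)" by measurable
      from measurable_compose[OF this plus] have
        [measurable]: "(\<lambda>z. \<lambda>i\<in>I. T (fst z) i + snd z i) \<in> measurable (L \<Otimes>\<^sub>M L) L" by simp
      show ?thesis unfolding split_beta by measurable
    qed
    have m2: "(\<lambda>(x, y). f (\<lambda>i\<in>I. T x i - y i) * g (T x)) \<in> borel_measurable (L \<Otimes>\<^sub>M L)"
    proof -
      have "(\<lambda>z. (T (fst z), snd z)) \<in> measurable (L \<Otimes>\<^sub>M L) (L \<Otimes>\<^sub>M L)" by measurable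
      from measurable_compose[OF this minus] have
        [measurable]: "(\<lambda>z. \<lambda>i\<in>I. T (fst z) i - snd z i) \<in> measurable (L \<Otimes>\<^sub>M L) L" by simp
      show ?thesis unfolding split_beta by measurable
    qed
    have "(\<integral>\<^sup>+x. f (T x) \<partial>L) * (\<integral>\<^sup>+x. g x \<partial>L) = (\<integral>\<^sup>+x. f (T x) * (\<integral>\<^sup>+y. g y \<partial>L) \<partial>L)"
      by (simp add: nn_integral_multc)
    also have "\<dots> = (\<integral>\<^sup>+x. f (T x) * (\<integral>\<^sup>+y. g (\<lambda>i\<in>I. T x i + y i) \<partial>L) \<partial>L)"
    proof (rule nn_integral_cong)
      fix x
      show "f (T x) * (\<integral>\<^sup>+y. g y \<partial>L) = f (T x) * (\<integral>\<^sup>+y. g (\<lambda>i\<in>I. T x i + y i) \<partial>L)"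
        using affine[of 1 g "T x"] by simp
    qed
    also have "\<dots> = (\<integral>\<^sup>+x. \<integral>\<^sup>+y. f (T x) * g (\<lambda>i\<in>I. T x i + y i) \<partial>L \<partial>L)"
    proof (rule nn_integral_cong)
      fix x assume "x \<in> space L"
      then have [measurable]: "(\<lambda>y. \<lambda>i\<in>I. T x i + y i) \<in> measurable L L"
        unfolding L_def by measurable
      show "f (T x) * (\<integral>\<^sup>+y. g (\<lambda>i\<in>I. T x i + y i) \<partial>L) = (\<integral>\<^sup>+y. f (T x) * g (\<lambda>i\<in>I. T x i + y i) \<partial>L)"
        by (rule nn_integral_cmult[symmetric]) measurable
    qed
    also have "\<dots> = (\<integral>\<^sup>+y. \<integral>\<^sup>+x. f (T x) * g (\<lambda>i\<in>I. T x i + y i) \<partial>L \<partial>L)"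
      by (rule Fubini'[OF m1, symmetric])
    also have "\<dots> = (\<integral>\<^sup>+y. \<integral>\<^sup>+x. f (\<lambda>i\<in>I. T x i - y i) * g (T x) \<partial>L \<partial>L)"
    proof (rule nn_integral_cong)
      fix y assume y: "y \<in> space L"
      \<comment> \<open>Surjectivity enters here: a translation by \<open>y\<close> after
        \<open>T\<close> becomes a translation by \<open>w\<close> before \<open>T\<close>, under
        which \<open>L\<close> is known to be invariant.\<close>
      then obtain w where w: "w \<in> space L" "T w = y" using surj by blast
      have [measurable]: "(\<lambda>x. \<lambda>i\<in>I. x i + y i) \<in> measurable L L"
        unfolding L_def by measurable
      have "(\<integral>\<^sup>+x. f (T x) * g (\<lambda>i\<in>I. T x i + y i) \<partial>L) =
          (\<integral>\<^sup>+x. f (T (\<lambda>i\<in>I. - w i + 1 * x i)) * g (\<lambda>i\<in>I. T (\<lambda>i\<in>I. - w i + 1 * x i) i + y i) \<partial>L)"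
        by (rule affine[of 1 "\<lambda>x. f (T x) * g (\<lambda>i\<in>I. T x i + y i)" "\<lambda>i. - w i", symmetric]) simp_all
      also have "\<dots> = (\<integral>\<^sup>+x. f (\<lambda>i\<in>I. T x i - y i) * g (T x) \<partial>L)"
      proof (rule nn_integral_cong)
        fix x assume x: "x \<in> space L"
        have "T (\<lambda>i\<in>I. - w i + 1 * x i) = (\<lambda>i\<in>I. T x i - y i)"
          using sub[OF x w(1)] w(2) by (simp add: algebra_simps cong: restrict_cong)
        moreover have "(\<lambda>i\<in>I. (\<lambda>i\<in>I. T x i - y i) i + y i) = T x"
          using T_sp[OF x] by (auto simp: L_def space_PiM PiE_def extensional_def fun_eq_iff)
        ultimately show "f (T (\<lambda>i\<in>I. - w i + 1 * x i)) * g (\<lambda>i\<in>I. T (\<lambda>i\<in>I. - w i + 1 * x i) i + y i) =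
            f (\<lambda>i\<in>I. T x i - y i) * g (T x)" by simp
      qed
      finally show "(\<integral>\<^sup>+x. f (T x) * g (\<lambda>i\<in>I. T x i + y i) \<partial>L) =
          (\<integral>\<^sup>+x. f (\<lambda>i\<in>I. T x i - y i) * g (T x) \<partial>L)" .
    qed
    also have "\<dots> = (\<integral>\<^sup>+x. \<integral>\<^sup>+y. f (\<lambda>i\<in>I. T x i - y i) * g (T x) \<partial>L \<partial>L)"
      by (rule Fubini'[OF m2])
    also have "\<dots> = (\<integral>\<^sup>+x. (\<integral>\<^sup>+y. f (\<lambda>i\<in>I. T x i - y i) \<partial>L) * g (T x) \<partial>L)"
    proof (rule nn_integral_cong)
      fix x assume "x \<in> space L"
      have [measurable]: "(\<lambda>y. \<lambda>i\<in>I. T x i - y i) \<in> measurable L L"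
        unfolding L_def by measurable
      show "(\<integral>\<^sup>+y. f (\<lambda>i\<in>I. T x i - y i) * g (T x) \<partial>L) = (\<integral>\<^sup>+y. f (\<lambda>i\<in>I. T x i - y i) \<partial>L) * g (T x)"
        by (rule nn_integral_multc) measurable
    qed
    also have "\<dots> = (\<integral>\<^sup>+x. (\<integral>\<^sup>+y. f y \<partial>L) * g (T x) \<partial>L)"
    proof (rule nn_integral_cong)
      fix x
      show "(\<integral>\<^sup>+y. f (\<lambda>i\<in>I. T x i - y i) \<partial>L) * g (T x) = (\<integral>\<^sup>+y. f y \<partial>L) * g (T x)"
        using affine[of "-1" f "T x"] by simp
    qed
    also have "\<dots> = (\<integral>\<^sup>+x. g (T x) \<partial>L) * (\<integral>\<^sup>+x. f x \<partial>L)"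
      by (simp add: nn_integral_cmult mult.commute)
    finally show ?thesis .
  qed
  define B where "B = {x \<in> space L. (\<Sum>i\<in>I. (x i)\<^sup>2) \<le> card I}"
  have B [measurable]: "B \<in> sets L" unfolding B_def L_def by measurable
  \<comment> \<open>Cancelling the factor \<open>emeasure L B\<close> in \<open>ennreal\<close>
    requires it to be neither zero nor infinite.\<close>
  have B_fin: "emeasure L B < \<infinity>" and B_pos: "emeasure L B > 0"
    unfolding B_def L_def
    using emeasure_PiM_lborel_ball_finite[OF fin] emeasure_PiM_lborel_ball_pos[OF fin] by blast+
  show ?thesis
  proof (rule measure_eqI)
    fix A assume "A \<in> sets (distr L L T)"
    then have A [measurable]: "A \<in> sets L" by simp
    have ind: "(\<integral>\<^sup>+x. indicator C (T x) \<partial>L) = emeasure (distr L L T) C" if "C \<in> sets L" for C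
      using that by (simp add: nn_integral_distr flip: nn_integral_indicator)
    have "(\<integral>\<^sup>+x. indicator B (T x) \<partial>L) = (\<integral>\<^sup>+x. indicator B x \<partial>L)"
      by (intro nn_integral_cong) (simp add: B_def indicator_def isom T_sp)
    then have "emeasure (distr L L T) A * emeasure L B = emeasure L A * emeasure L B"
      using proportional[of "indicator A" "indicator B"] by (simp add: ind mult.commute)
    then show "emeasure (distr L L T) A = emeasure L A"
      using B_fin B_pos by (auto simp: mult.commute[of _ "emeasure L B"] ennreal_mult_cancel_left)
  qed simp
qed

section \<open>Orthogonal matrices\<close>

text \<open>A one-sided inverse of a square matrix is two-sided, so \<open>A * B = 1\<close> with
  \<open>B\<close> the transpose of \<open>A\<close> yields \<open>B * A = 1\<close>. This connects
  the row relations that define \<open>orth_mats\<close> with the column relations that Gram-Schmidt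
  and the moment recurrences work with.\<close>

lemma gram_transpose:
  fixes f :: "nat \<Rightarrow> nat \<Rightarrow> real"
  assumes "\<And>i j. i < n \<Longrightarrow> j < n \<Longrightarrow> (\<Sum>k<n. f i k * f j k) = (if i = j then 1 else 0)"
    and "i < n" "j < n"
  shows "(\<Sum>k<n. f k i * f k j) = (if i = j then 1 else 0)"
proof -
  define A where "A = Matrix.mat n n (\<lambda>(i, j). f i j)"
  define B where "B = Matrix.mat n n (\<lambda>(i, j). f j i)"
  have AB: "A \<in> carrier_mat n n" "B \<in> carrier_mat n n" by (auto simp: A_def B_def)
  have "A * B = 1\<^sub>m n"
    by (rule eq_matI) (auto simp: A_def B_def scalar_prod_def atLeast0LessThan assms(1))
  then have "B * A = 1\<^sub>m n" using mat_mult_left_right_inverse AB by blast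
  then have "(B * A) $$ (i, j) = (if i = j then 1 else 0)" using assms by simp
  then show ?thesis using assms(2,3)
    by (simp add: A_def B_def scalar_prod_def atLeast0LessThan)
qed

section \<open>Row and column relations, measurability, and left multiplication\<close>

lemma orth_mats_space: "U \<in> orth_mats n \<Longrightarrow> U \<in> space (mat_space n)"
  by (simp add: orth_mats_def)

lemma orth_mats_rows:
  "U \<in> orth_mats n \<Longrightarrow> i < n \<Longrightarrow> j < n \<Longrightarrow>
    (\<Sum>k<n. U (i, k) * U (j, k)) = (if i = j then 1 else 0)"
  by (simp add: orth_mats_def)

lemma orth_mats_cols:
  "U \<in> orth_mats n \<Longrightarrow> i < n \<Longrightarrow> j < n \<Longrightarrow>
    (\<Sum>k<n. U (k, i) * U (k, j)) = (if i = j then 1 else 0)"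
  by (rule gram_transpose[of n "\<lambda>i j. U (i, j)"]) (auto simp: orth_mats_def)

lemma orth_matsI_cols:
  assumes "U \<in> space (mat_space n)"
    and "\<And>i j. i < n \<Longrightarrow> j < n \<Longrightarrow> (\<Sum>k<n. U (k, i) * U (k, j)) = (if i = j then 1 else 0)"
  shows "U \<in> orth_mats n"
  using gram_transpose[of n "\<lambda>i j. U (j, i)"] assms by (simp add: orth_mats_def)

lemma space_mat_space: "space (mat_space n) = ({..<n} \<times> {..<n}) \<rightarrow>\<^sub>E UNIV"
  by (simp add: mat_space_def space_PiM)

lemma mat_mult_in_space [simp]: "mat_mult n Q U \<in> space (mat_space n)"
  by (auto simp: space_mat_space mat_mult_def)

lemma mat_mult_apply:
  "i < n \<Longrightarrow> j < n \<Longrightarrow> mat_mult n Q U (i, j) = (\<Sum>k<n. Q (i, k) * U (k, j))"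
  by (simp add: mat_mult_def)

lemma measurable_mat_entry [measurable]:
  "i < n \<Longrightarrow> j < n \<Longrightarrow> (\<lambda>U. U (i, j)) \<in> borel_measurable (mat_space n)"
  unfolding mat_space_def by (rule measurable_component_singleton) simp

lemma measurable_mat_mult [measurable]: "mat_mult n Q \<in> measurable (mat_space n) (mat_space n)"
proof -
  have "(\<lambda>U. mat_mult n Q U) \<in> measurable (mat_space n) (PiM ({..<n} \<times> {..<n}) (\<lambda>_. borel))"
    unfolding mat_mult_def by (rule measurable_restrict) (auto intro!: borel_measurable_sum)
  then show ?thesis by (simp add: mat_space_def)
qed

lemma sets_orth_mats [measurable]: "orth_mats n \<in> sets (mat_space n)"
  unfolding orth_mats_def by measurable auto

text \<open>After expansion, summing over the row index \<open>l\<close> first leaves the Gram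
  matrix of the columns of \<open>Q\<close>, which is the identity. So \<open>Q\<close> preserves
  inner products.\<close>

lemma sum_mult_orth:
  assumes "Q \<in> orth_mats n"
  shows "(\<Sum>l<n. (\<Sum>k<n. Q (l, k) * x k) * (\<Sum>k<n. Q (l, k) * y k)) = (\<Sum>k<n. x k * y k)"
proof -
  have "(\<Sum>l<n. (\<Sum>k<n. Q (l, k) * x k) * (\<Sum>k<n. Q (l, k) * y k)) =
      (\<Sum>l<n. \<Sum>k<n. \<Sum>m<n. Q (l, k) * Q (l, m) * (x k * y m))"
    by (simp add: sum_product algebra_simps)
  also have "\<dots> = (\<Sum>k<n. \<Sum>m<n. \<Sum>l<n. Q (l, k) * Q (l, m) * (x k * y m))"
    by (subst sum.swap, rule sum.cong[OF refl], rule sum.swap)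
  also have "\<dots> = (\<Sum>k<n. \<Sum>m<n. (if k = m then 1 else 0) * (x k * y m))"
    by (intro sum.cong refl) (simp add: orth_mats_cols[OF assms] flip: sum_distrib_right)
  also have "\<dots> = (\<Sum>k<n. x k * y k)"
    by (intro sum.cong refl) (simp add: if_distrib[of "\<lambda>t. t * _"] cong: if_cong)
  finally show ?thesis .
qed

text \<open>Left multiplication by \<open>Q\<close> does not change the Gram matrix of the columns.
  Both directions are used when the set \<open>S\<close> in the existence proof is shown to be
  invariant.\<close>

lemma mat_mult_orth_iff:
  assumes "Q \<in> orth_mats n" and U: "U \<in> space (mat_space n)"
  shows "mat_mult n Q U \<in> orth_mats n \<longleftrightarrow> U \<in> orth_mats n"
proof -
  have eq: "(\<Sum>k<n. mat_mult n Q U (k, i) * mat_mult n Q U (k, j)) = (\<Sum>k<n. U (k, i) * U (k, j))"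
    if "i < n" "j < n" for i j
    using sum_mult_orth[OF assms(1), of "\<lambda>k. U (k, i)" "\<lambda>k. U (k, j)"] that by (simp add: mat_mult_apply)
  show ?thesis
    using orth_matsI_cols[of "mat_mult n Q U" n] orth_matsI_cols[of U n]
      orth_mats_cols[of "mat_mult n Q U" n] orth_mats_cols[of U n] U
    by (smt (verit) eq mat_mult_in_space)
qed

lemma orth_mats_abs_le_1:
  assumes "U \<in> orth_mats n" "i < n" "j < n"
  shows "\<bar>U (i, j)\<bar> \<le> 1"
proof -
  have "U (i, j) * U (i, j) \<le> (\<Sum>k<n. U (i, k) * U (i, k))"
    using assms by (intro member_le_sum) auto
  also have "\<dots> = 1" using orth_mats_rows[OF assms(1,2,2)] by simp
  finally show ?thesis by (simp add: power2_eq_square flip: abs_square_le_1)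
qed

section \<open>Gram-Schmidt on the columns of a matrix\<close>

text \<open>Here \<open>r\<close> is column \<open>k\<close> of \<open>G\<close> minus its
  projections onto the columns already produced. When \<open>r\<close> vanishes, the convention
  \<open>x / 0 = 0\<close> yields the zero column, so the process is total and needs no case
  distinction for measurability.\<close>

fun gs_col :: "nat \<Rightarrow> (nat \<times> nat \<Rightarrow> real) \<Rightarrow> nat \<Rightarrow> nat \<Rightarrow> real" where
  "gs_col n G k =
    (let r = (\<lambda>i. G (i, k) - (\<Sum>j<k. (\<Sum>l<n. G (l, k) * gs_col n G j l) * gs_col n G j i))
     in (\<lambda>i. r i / sqrt (\<Sum>l<n. (r l)\<^sup>2)))"

declare gs_col.simps [simp del]

definition gs_res :: "nat \<Rightarrow> (nat \<times> nat \<Rightarrow> real) \<Rightarrow> nat \<Rightarrow> nat \<Rightarrow> real" where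
  "gs_res n G k i = G (i, k) - (\<Sum>j<k. (\<Sum>l<n. G (l, k) * gs_col n G j l) * gs_col n G j i)"

lemma gs_col_eq: "gs_col n G k i = gs_res n G k i / sqrt (\<Sum>l<n. (gs_res n G k l)\<^sup>2)"
  by (subst gs_col.simps) (simp add: gs_res_def Let_def)

text \<open>By induction every earlier normalised column is a combination of columns of
  \<open>G\<close> with index below \<open>k\<close>. What matters later is the coefficient 1 of
  column \<open>k\<close> itself: it makes a vanishing residual a nontrivial linear
  relation.\<close>

lemma gs_res_span: "\<exists>t. \<forall>i. gs_res n G k i = G (i, k) - (\<Sum>l<k. t l * G (i, l))"
proof (induction k rule: less_induct)
  case (less k)
  have "\<exists>s. \<forall>i. gs_col n G j i = (\<Sum>l<k. s l * G (i, l))" if j: "j < k" for j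
  proof -
    from less[OF j] obtain t where t: "\<And>i. gs_res n G j i = G (i, j) - (\<Sum>l<j. t l * G (i, l))"
      by blast
    define N where "N = sqrt (\<Sum>l<n. (gs_res n G j l)\<^sup>2)"
    \<comment> \<open>The coefficients of residual \<open>j\<close> divided by its norm, padded with
      zeros to the common length \<open>k\<close>. For \<open>N = 0\<close> they all become 0, in
      agreement with the zero column.\<close>
    define s where "s l = (if l = j then 1 else if l < j then - t l else 0) / N" for l
    have "gs_col n G j i = (\<Sum>l<k. s l * G (i, l))" for i
    proof -
      have "(\<Sum>l<k. s l * G (i, l)) = (\<Sum>l\<in>insert j {..<j}. s l * G (i, l))"
        using j by (intro sum.mono_neutral_right) (auto simp: s_def)
      also have "\<dots> = G (i, j) / N + (\<Sum>l<j. - (t l * G (i, l)) / N)"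
        by (simp add: s_def)
      also have "\<dots> = gs_col n G j i"
        unfolding gs_col_eq[of n G j i] N_def[symmetric] t[of i]
        by (simp add: diff_divide_distrib sum_negf flip: sum_divide_distrib)
      finally show ?thesis ..
    qed
    then show ?thesis by blast
  qed
  then obtain s where s: "\<And>j i. j < k \<Longrightarrow> gs_col n G j i = (\<Sum>l<k. s j l * G (i, l))"
    by metis
  define c where "c j = (\<Sum>l<n. G (l, k) * gs_col n G j l)" for j
  have "gs_res n G k i = G (i, k) - (\<Sum>l<k. (\<Sum>j<k. c j * s j l) * G (i, l))" for i
  proof -
    have "gs_res n G k i = G (i, k) - (\<Sum>j<k. \<Sum>l<k. c j * s j l * G (i, l))"
      unfolding gs_res_def c_def[symmetric] by (simp add: s sum_distrib_left mult.assoc)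
    also have "\<dots> = G (i, k) - (\<Sum>l<k. (\<Sum>j<k. c j * s j l) * G (i, l))"
      by (subst sum.swap) (simp add: sum_distrib_right)
    finally show ?thesis .
  qed
  then show ?case by (intro exI[of _ "\<lambda>l. \<Sum>j<k. c j * s j l"]) simp
qed

text \<open>Diagonal dominance: in row \<open>i\<close> with \<open>\<bar>c i\<bar>\<close> maximal,
  the relation gives \<open>\<bar>c i\<bar> \<le> n * (\<bar>c i\<bar> / (2 * n)) = \<bar>c i\<bar>
  / 2\<close>, which forces every coefficient to vanish.\<close>

lemma near_identity_independent:
  fixes c :: "nat \<Rightarrow> real" and G :: "nat \<times> nat \<Rightarrow> real"
  assumes near: "\<And>i j. i < n \<Longrightarrow> j < n \<Longrightarrow> \<bar>G (i, j) - (if i = j then 1 else 0)\<bar> \<le> 1 / (2 * real n)"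
    and dep: "\<And>i. i < n \<Longrightarrow> (\<Sum>l<n. c l * G (i, l)) = 0" and k: "k < n"
  shows "c k = 0"
proof -
  have "n > 0" using k by simp
  obtain i where i: "i < n" and max: "\<And>l. l < n \<Longrightarrow> \<bar>c l\<bar> \<le> \<bar>c i\<bar>"
  proof -
    have "finite ((\<lambda>l. \<bar>c l\<bar>) ` {..<n})" "(\<lambda>l. \<bar>c l\<bar>) ` {..<n} \<noteq> {}" using k by auto
    from Max_in[OF this] Max_ge[OF this(1)] that show thesis by fastforce
  qed
  have "c i = (\<Sum>l<n. c l * (if i = l then 1 else 0)) - (\<Sum>l<n. c l * G (i, l))"
    using i dep by (simp add: if_distrib cong: if_cong)
  also have "\<dots> = (\<Sum>l<n. - (c l * (G (i, l) - (if i = l then 1 else 0))))"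
    by (simp add: sum_subtractf[symmetric] algebra_simps)
  finally have "\<bar>c i\<bar> \<le> (\<Sum>l<n. \<bar>c l * (G (i, l) - (if i = l then 1 else 0))\<bar>)"
    by (metis (no_types, lifting) abs_minus_cancel sum.cong sum_abs)
  also have "\<dots> \<le> (\<Sum>l<n. \<bar>c i\<bar> * (1 / (2 * real n)))"
    unfolding abs_mult using near[OF i] max by (intro sum_mono mult_mono) auto
  also have "\<dots> = \<bar>c i\<bar> / 2" using \<open>n > 0\<close> by simp
  finally have "c i = 0" by simp
  with max[OF k] show ?thesis by simp
qed

text \<open>A zero residual would be a linear relation among the columns of \<open>G\<close> whose
  coefficient at \<open>k\<close> is 1, contrary to their independence near the identity.\<close>

lemma gs_res_nonzero:
  assumes near: "\<And>i j. i < n \<Longrightarrow> j < n \<Longrightarrow> \<bar>G (i, j) - (if i = j then 1 else 0)\<bar> \<le> 1 / (2 * real n)"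
    and k: "k < n"
  shows "(\<Sum>l<n. (gs_res n G k l)\<^sup>2) \<noteq> 0"
proof
  assume "(\<Sum>l<n. (gs_res n G k l)\<^sup>2) = 0"
  then have zero: "gs_res n G k i = 0" if "i < n" for i
    using that by (simp add: sum_nonneg_eq_0_iff)
  obtain t where t: "\<And>i. gs_res n G k i = G (i, k) - (\<Sum>l<k. t l * G (i, l))"
    using gs_res_span[of n G k] by blast
  define c where "c l = (if l = k then 1 else if l < k then - t l else 0)" for l
  have comb: "(\<Sum>l<n. c l * G (i, l)) = gs_res n G k i" for i
  proof -
    have "(\<Sum>l<n. c l * G (i, l)) = (\<Sum>l\<in>insert k {..<k}. c l * G (i, l))"
      using k by (intro sum.mono_neutral_right) (auto simp: c_def)
    then show ?thesis by (simp add: c_def t sum_negf)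
  qed
  have "c k = 0" by (rule near_identity_independent[OF near _ k]) (simp_all add: comb zero)
  then show False by (simp add: c_def)
qed

lemma gs_col_orthonormal:
  assumes nz: "\<And>k. k < n \<Longrightarrow> (\<Sum>l<n. (gs_res n G k l)\<^sup>2) \<noteq> 0"
    and "j < n" "k < n"
  shows "(\<Sum>i<n. gs_col n G j i * gs_col n G k i) = (if j = k then 1 else 0)"
proof -
  \<comment> \<open>Strong induction on the larger index, comparing column \<open>k\<close> with all
    \<open>j \<le> k\<close>; the other order follows by symmetry.\<close>
  have *: "\<forall>j\<le>k. (\<Sum>i<n. gs_col n G j i * gs_col n G k i) = (if j = k then 1 else 0)" if "k < n" for k
    using that
  proof (induction k rule: less_induct)
    case (less k)
    have IH: "(\<Sum>i<n. gs_col n G j i * gs_col n G j' i) = (if j = j' then 1 else 0)"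
      if "j < k" "j' < k" for j j'
    proof (cases "j \<le> j'")
      case True
      then show ?thesis using less that by simp
    next
      case False
      then show ?thesis using less.IH[of j] less.prems that by (simp add: mult.commute)
    qed
    define N where "N = (\<Sum>l<n. (gs_res n G k l)\<^sup>2)"
    have N: "N > 0" using nz[OF less.prems] by (simp add: N_def order_neq_le_trans sum_nonneg)
    have col: "gs_col n G k i = gs_res n G k i / sqrt N" for i by (simp add: gs_col_eq N_def)
    show ?case
    proof (intro allI impI)
      fix j assume "j \<le> k"
      then consider "j = k" | "j < k" by linarith
      then show "(\<Sum>i<n. gs_col n G j i * gs_col n G k i) = (if j = k then 1 else 0)"
      proof cases
        case 1
        have "(\<Sum>i<n. gs_col n G k i * gs_col n G k i) = (\<Sum>i<n. (gs_res n G k i)\<^sup>2 / N)"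
          using N by (simp add: col power2_eq_square)
        also have "\<dots> = 1" using N by (simp add: N_def flip: sum_divide_distrib)
        finally show ?thesis using 1 by simp
      next
        case 2
        \<comment> \<open>\<open>c j\<close> is the component of column \<open>k\<close> of
          \<open>G\<close> along the new column \<open>j\<close>. By the induction hypothesis only
          the term \<open>j' = j\<close> of the subtracted projections survives, and it cancels
          \<open>c j\<close>.\<close>
        define c where "c j = (\<Sum>l<n. G (l, k) * gs_col n G j l)" for j
        have "(\<Sum>i<n. gs_col n G j i * gs_res n G k i) =
            c j - (\<Sum>i<n. \<Sum>j'<k. c j' * (gs_col n G j i * gs_col n G j' i))"
          by (simp add: gs_res_def c_def right_diff_distrib sum_subtractf sum_distrib_left
              mult.commute mult.left_commute)
        also have "(\<Sum>i<n. \<Sum>j'<k. c j' * (gs_col n G j i * gs_col n G j' i)) =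
            (\<Sum>j'<k. c j' * (if j = j' then 1 else 0))"
          by (subst sum.swap) (simp add: IH 2 flip: sum_distrib_left)
        also have "\<dots> = c j" using 2 by (simp add: if_distrib cong: if_cong)
        finally have "(\<Sum>i<n. gs_col n G j i * gs_res n G k i) = 0" by simp
        with 2 show ?thesis by (simp add: col flip: sum_divide_distrib)
      qed
    qed
  qed
  show ?thesis
  proof (cases "j \<le> k")
    case True
    then show ?thesis using * assms by simp
  next
    case False
    then have "(\<Sum>i<n. gs_col n G k i * gs_col n G j i) = 0" using *[OF assms(2)] by simp
    then show ?thesis using False by (simp add: mult.commute)
  qed
qed

text \<open>The coefficients of Gram-Schmidt are inner products and norms, which \<open>Q\<close>
  preserves; hence every step of the process commutes with \<open>Q\<close>.\<close>

lemma gs_col_mat_mult: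
  assumes Q: "Q \<in> orth_mats n" and "k < n" "i < n"
  shows "gs_col n (mat_mult n Q G) k i = (\<Sum>m<n. Q (i, m) * gs_col n G k m)"
  using assms(2,3)
proof (induction k arbitrary: i rule: less_induct)
  case (less k)
  have res: "gs_res n (mat_mult n Q G) k i = (\<Sum>m<n. Q (i, m) * gs_res n G k m)" if "i < n" for i
  proof -
    have ip: "(\<Sum>l<n. mat_mult n Q G (l, k) * gs_col n (mat_mult n Q G) j l) =
        (\<Sum>l<n. G (l, k) * gs_col n G j l)" if "j < k" for j
      using sum_mult_orth[OF Q, of "\<lambda>l. G (l, k)" "gs_col n G j"] that less
      by (simp add: mat_mult_apply)
    have "gs_res n (mat_mult n Q G) k i = mat_mult n Q G (i, k) -
        (\<Sum>j<k. (\<Sum>l<n. G (l, k) * gs_col n G j l) * gs_col n (mat_mult n Q G) j i)"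
      by (simp add: gs_res_def ip)
    also have "\<dots> = (\<Sum>m<n. Q (i, m) * G (m, k)) -
        (\<Sum>j<k. (\<Sum>l<n. G (l, k) * gs_col n G j l) * (\<Sum>m<n. Q (i, m) * gs_col n G j m))"
      using that less by (simp add: mat_mult_apply)
    also have "(\<Sum>j<k. (\<Sum>l<n. G (l, k) * gs_col n G j l) * (\<Sum>m<n. Q (i, m) * gs_col n G j m)) =
        (\<Sum>m<n. Q (i, m) * (\<Sum>j<k. (\<Sum>l<n. G (l, k) * gs_col n G j l) * gs_col n G j m))"
      unfolding sum_distrib_left[of _ _ "{..<n}"] sum_distrib_left[of _ _ "{..<k}"]
      by (subst sum.swap) (simp add: mult.left_commute)
    finally show ?thesis by (simp add: gs_res_def right_diff_distrib sum_subtractf)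
  qed
  have "(\<Sum>l<n. (gs_res n (mat_mult n Q G) k l)\<^sup>2) = (\<Sum>l<n. (gs_res n G k l)\<^sup>2)"
    using sum_mult_orth[OF Q, of "gs_res n G k" "gs_res n G k"] by (simp add: res power2_eq_square)
  then show ?case using less.prems by (simp add: gs_col_eq res sum_divide_distrib)
qed

lemma measurable_gs_col:
  assumes "k < n" "i < n"
  shows "(\<lambda>G. gs_col n G k i) \<in> borel_measurable (mat_space n)"
  using assms
proof (induction k arbitrary: i rule: less_induct)
  case (less k)
  have res: "(\<lambda>G. gs_res n G k i) \<in> borel_measurable (mat_space n)" if "i < n" for i
    unfolding gs_res_def using that less
    by (intro borel_measurable_diff borel_measurable_sum borel_measurable_times measurable_mat_entry) auto
  have "(\<lambda>G. \<Sum>l<n. (gs_res n G k l)\<^sup>2) \<in> borel_measurable (mat_space n)"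
    by (intro borel_measurable_sum borel_measurable_power res) simp
  with res[OF less.prems(2)] show ?case unfolding gs_col_eq by measurable
qed

definition gs_mat :: "nat \<Rightarrow> (nat \<times> nat \<Rightarrow> real) \<Rightarrow> (nat \<times> nat \<Rightarrow> real)" where
  "gs_mat n G = restrict (\<lambda>(i, k). gs_col n G k i) ({..<n} \<times> {..<n})"

lemma measurable_gs_mat [measurable]: "gs_mat n \<in> measurable (mat_space n) (mat_space n)"
proof -
  have "(\<lambda>G. gs_mat n G) \<in> measurable (mat_space n) (PiM ({..<n} \<times> {..<n}) (\<lambda>_. borel))"
    unfolding gs_mat_def by (rule measurable_restrict) (auto intro!: measurable_gs_col)
  then show ?thesis by (simp add: mat_space_def)
qed

lemma gs_mat_mat_mult:
  assumes "Q \<in> orth_mats n"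
  shows "gs_mat n (mat_mult n Q G) = mat_mult n Q (gs_mat n G)"
proof -
  have "gs_col n (mat_mult n Q G) k i = (\<Sum>m<n. Q (i, m) * gs_mat n G (m, k))" if "i < n" "k < n" for i k
    using gs_col_mat_mult[OF assms] that by (simp add: gs_mat_def)
  then show ?thesis
    unfolding gs_mat_def[of _ "mat_mult n Q G"] mat_mult_def[of n Q "gs_mat n G"]
    by (intro restrict_ext) auto
qed

text \<open>This supplies a cube of positive volume on which Gram-Schmidt succeeds, which is enough
  to normalise Lebesgue measure in the existence proof.\<close>

lemma gs_mat_orth_near_identity:
  assumes "\<And>i j. i < n \<Longrightarrow> j < n \<Longrightarrow> \<bar>G (i, j) - (if i = j then 1 else 0)\<bar> \<le> 1 / (2 * real n)"
  shows "gs_mat n G \<in> orth_mats n"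
proof (rule orth_matsI_cols)
  show "gs_mat n G \<in> space (mat_space n)" by (auto simp: space_mat_space gs_mat_def)
qed (use gs_col_orthonormal[OF gs_res_nonzero[OF assms]] in \<open>simp add: gs_mat_def\<close>)

section \<open>Existence of the Haar measure\<close>

abbreviation mat_lborel :: "nat \<Rightarrow> (nat \<times> nat \<Rightarrow> real) measure" where
  "mat_lborel n \<equiv> PiM ({..<n} \<times> {..<n}) (\<lambda>_. lborel)"

lemma sets_mat_lborel [measurable_cong]: "sets (mat_lborel n) = sets (mat_space n)"
  unfolding mat_space_def by (rule sets_PiM_cong) auto

lemma space_mat_lborel: "space (mat_lborel n) = space (mat_space n)"
  using sets_eq_imp_space_eq[OF sets_mat_lborel] .

lemma sum_squares_mat_mult:
  assumes Q: "Q \<in> orth_mats n"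
  shows "(\<Sum>i\<in>{..<n} \<times> {..<n}. (mat_mult n Q x i)\<^sup>2) = (\<Sum>i\<in>{..<n} \<times> {..<n}. (x i)\<^sup>2)"
proof -
  have "(\<Sum>i\<in>{..<n} \<times> {..<n}. (mat_mult n Q x i)\<^sup>2) =
      (\<Sum>j<n. \<Sum>l<n. (\<Sum>k<n. Q (l, k) * x (k, j)) * (\<Sum>k<n. Q (l, k) * x (k, j)))"
    unfolding sum.cartesian_product'
    by (subst sum.swap) (simp add: mat_mult_apply power2_eq_square)
  also have "\<dots> = (\<Sum>j<n. \<Sum>l<n. x (l, j) * x (l, j))"
    by (simp only: sum_mult_orth[OF Q])
  also have "\<dots> = (\<Sum>i\<in>{..<n} \<times> {..<n}. (x i)\<^sup>2)"
    unfolding sum.cartesian_product' by (subst sum.swap) (simp add: power2_eq_square)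
  finally show ?thesis .
qed

lemma distr_mat_lborel_mat_mult:
  assumes Q: "Q \<in> orth_mats n"
  shows "distr (mat_lborel n) (mat_lborel n) (mat_mult n Q) = mat_lborel n"
proof (rule distr_PiM_lborel_isometry)
  show "mat_mult n Q \<in> measurable (mat_lborel n) (mat_lborel n)" by measurable
next
  fix x y
  show "mat_mult n Q (\<lambda>i\<in>{..<n} \<times> {..<n}. x i - y i) =
      (\<lambda>i\<in>{..<n} \<times> {..<n}. mat_mult n Q x i - mat_mult n Q y i)"
    by (auto simp: mat_mult_def fun_eq_iff right_diff_distrib sum_subtractf)
next
  fix y assume "y \<in> space (mat_lborel n)"
  then have y: "y \<in> space (mat_space n)" by (simp add: space_mat_lborel)
  \<comment> \<open>The preimage of \<open>y\<close> is its product with the transpose of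
    \<open>Q\<close>, the inverse of an orthogonal matrix.\<close>
  define x where "x = mat_mult n (\<lambda>(i, j). Q (j, i)) y"
  have "mat_mult n Q x (i, j) = y (i, j)" if "i < n" "j < n" for i j
  proof -
    have "mat_mult n Q x (i, j) = (\<Sum>k<n. \<Sum>m<n. Q (i, k) * Q (m, k) * y (m, j))"
      using that by (simp add: x_def mat_mult_apply sum_distrib_left mult.assoc)
    also have "\<dots> = (\<Sum>m<n. (if i = m then 1 else 0) * y (m, j))"
      using that by (subst sum.swap) (simp add: orth_mats_rows[OF Q] flip: sum_distrib_right)
    also have "\<dots> = y (i, j)" using that by (simp add: if_distrib[of "\<lambda>t. t * _"] cong: if_cong)
    finally show ?thesis .
  qed
  then have "mat_mult n Q x = y"
    using y mat_mult_in_space[of n Q x] unfolding space_mat_space by (intro PiE_ext) auto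
  then show "\<exists>x\<in>space (mat_lborel n). mat_mult n Q x = y"
    by (intro bexI[of _ x]) (simp_all add: x_def space_mat_lborel)
qed (simp_all add: sum_squares_mat_mult[OF Q])

text \<open>Lebesgue measure on matrices is infinite, so it is first conditioned on a set
  \<open>S\<close> that is invariant under left multiplication by orthogonal matrices and has finite
  positive volume. The resulting \<open>P\<close> is invariant, and so is its image under
  Gram-Schmidt.\<close>

lemma haar_On_exists: "\<exists>M. is_haar_On n M"
proof -
  define I where "I = {..<n} \<times> {..<n}"
  define L where "L = mat_lborel n"
  have sets_L [measurable_cong]: "sets L = sets (mat_space n)" by (simp add: L_def sets_mat_lborel)
  have space_L: "space L = space (mat_space n)" by (simp add: L_def space_mat_lborel)
  \<comment> \<open>The factor 4 makes room for the cube \<open>K\<close> around the identity, whose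
    matrices have entries of absolute value at most 2. The second condition discards the matrices on
    which Gram-Schmidt breaks down.\<close>
  define S where "S = {G \<in> space L. (\<Sum>i\<in>I. (G i)\<^sup>2) \<le> 4 * card I \<and> gs_mat n G \<in> orth_mats n}"
  have comp [measurable]: "(\<lambda>G. G i) \<in> borel_measurable L" if "i \<in> I" for i
    unfolding measurable_cong_sets[OF sets_L refl]
    using that by (cases i) (auto simp: I_def intro: measurable_mat_entry)
  have S [measurable]: "S \<in> sets L" unfolding S_def by measurable
  have "emeasure L S \<le> emeasure L {x \<in> space L. (\<Sum>i\<in>I. (x i)\<^sup>2) \<le> 4 * card I}"
    by (rule emeasure_mono) (auto simp: S_def)
  also have "\<dots> < \<infinity>"
    unfolding L_def I_def by (rule emeasure_PiM_lborel_ball_finite) simp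
  finally have S_fin: "emeasure L S < \<infinity>" .
  have S_pos: "emeasure L S > 0"
  proof -
    interpret product_sigma_finite "\<lambda>_::nat \<times> nat. lborel :: real measure" by standard
    define \<delta> :: "nat \<times> nat \<Rightarrow> real" where "\<delta> = (\<lambda>(i, j). if i = j then 1 else 0)"
    define K where "K = Pi\<^sub>E I (\<lambda>i. {\<delta> i - 1 / (2 * real n) .. \<delta> i + 1 / (2 * real n)})"
    have [measurable]: "K \<in> sets L"
      unfolding K_def L_def I_def by (intro sets_PiM_I_finite) auto
    have "K \<subseteq> S"
    proof
      fix G assume G: "G \<in> K"
      have near: "\<bar>G i - \<delta> i\<bar> \<le> 1 / (2 * real n)" if "i \<in> I" for i
        using G that by (force simp: K_def PiE_iff abs_le_iff)
      have "(\<Sum>i\<in>I. (G i)\<^sup>2) \<le> (\<Sum>i\<in>I. 2\<^sup>2)"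
      proof (rule sum_mono)
        fix i assume i: "i \<in> I"
        then have "n \<ge> 1" by (auto simp: I_def)
        then have "1 / (2 * real n) \<le> 1" by simp
        moreover have "\<delta> i \<in> {0..1}" by (simp add: \<delta>_def split: prod.splits)
        ultimately have "\<bar>G i\<bar> \<le> \<bar>2\<bar>" using near[OF i] by auto
        then show "(G i)\<^sup>2 \<le> 2\<^sup>2" by (simp only: abs_le_square_iff)
      qed
      moreover have "gs_mat n G \<in> orth_mats n"
      proof (rule gs_mat_orth_near_identity)
        fix i j assume "i < n" "j < n"
        then show "\<bar>G (i, j) - (if i = j then 1 else 0)\<bar> \<le> 1 / (2 * real n)"
          using near[of "(i, j)"] by (simp add: \<delta>_def I_def)
      qed
      moreover have "G \<in> space L" using G by (auto simp: K_def L_def I_def space_PiM)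
      ultimately show "G \<in> S" by (simp add: S_def mult.commute)
    qed
    \<comment> \<open>The cube has side \<open>1 / n\<close>. For \<open>n = 0\<close> the index set
      is empty and the power is \<open>0 ^ 0 = 1\<close>.\<close>
    have "0 < ennreal ((1 / real n) ^ card I)" by (cases n) (simp_all add: I_def)
    also have "\<dots> = (\<Prod>i\<in>I. emeasure lborel {\<delta> i - 1 / (2 * real n) .. \<delta> i + 1 / (2 * real n)})"
      by (simp add: emeasure_lborel_Icc_eq ennreal_power)
    also have "\<dots> = emeasure L K"
      unfolding K_def L_def I_def by (intro emeasure_PiM[symmetric]) auto
    also have "\<dots> \<le> emeasure L S" using \<open>K \<subseteq> S\<close> by (rule emeasure_mono) measurable
    finally show ?thesis .
  qed
  define P where "P = uniform_measure L S"
  have sets_P [measurable_cong]: "sets P = sets (mat_space n)" by (simp add: P_def sets_L)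
  have space_P: "space P = space (mat_space n)" by (simp add: P_def space_L)
  interpret P: prob_space P
    unfolding P_def using S_pos S_fin by (intro prob_space_uniform_measure) auto
  have P_inv: "distr P (mat_space n) (mat_mult n Q) = P" if Q: "Q \<in> orth_mats n" for Q
  proof (rule measure_eqI)
    fix A assume "A \<in> sets (distr P (mat_space n) (mat_mult n Q))"
    then have A [measurable]: "A \<in> sets (mat_space n)" by simp
    have gs_sp: "gs_mat n G \<in> space (mat_space n)" for G
      by (auto simp: space_mat_space gs_mat_def)
    have "mat_mult n Q G \<in> S \<longleftrightarrow> G \<in> S" if "G \<in> space L" for G
      using that by (simp add: S_def I_def sum_squares_mat_mult[OF Q] space_L gs_mat_mat_mult[OF Q] mat_mult_orth_iff[OF Q gs_sp])
    \<comment> \<open>Invariance of \<open>S\<close> moves it inside the preimage, so the invariance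
      of \<open>L\<close> applies to \<open>S \<inter> A\<close>.\<close>
    then have pre: "S \<inter> (mat_mult n Q -` A \<inter> space P) = mat_mult n Q -` (S \<inter> A) \<inter> space L"
      using sets.sets_into_space[OF S] by (auto simp: space_P space_L)
    have "emeasure (distr P (mat_space n) (mat_mult n Q)) A = emeasure P (mat_mult n Q -` A \<inter> space P)"
      by (rule emeasure_distr) measurable
    also have "\<dots> = emeasure L (S \<inter> (mat_mult n Q -` A \<inter> space P)) / emeasure L S"
      unfolding P_def by (rule emeasure_uniform_measure) (simp_all, measurable)
    also have "\<dots> = emeasure (distr L L (mat_mult n Q)) (S \<inter> A) / emeasure L S"
      unfolding pre by (subst emeasure_distr) (simp_all, measurable)
    also have "\<dots> = emeasure L (S \<inter> A) / emeasure L S"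
      unfolding L_def by (simp only: distr_mat_lborel_mat_mult[OF Q])
    also have "\<dots> = emeasure P A"
      unfolding P_def using S by (intro emeasure_uniform_measure[symmetric]) (simp_all add: sets_L)
    finally show "emeasure (distr P (mat_space n) (mat_mult n Q)) A = emeasure P A" .
  qed (simp add: sets_P)
  define M where "M = distr P (mat_space n) (gs_mat n)"
  have "is_haar_On n M"
    unfolding is_haar_On_def
  proof (intro conjI ballI)
    show "sets M = sets (mat_space n)" by (simp add: M_def)
    show "prob_space M" unfolding M_def by (rule P.prob_space_distr) measurable
    have "AE G in P. gs_mat n G \<in> orth_mats n"
      unfolding P_def using S_pos S_fin
      by (intro AE_uniform_measureI) (auto simp: S_def)
    then have "AE U in M. U \<in> orth_mats n"
      unfolding M_def by (subst AE_distr_iff) (simp_all, measurable)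
    then show "emeasure M (orth_mats n) = 1"
      using prob_space.emeasure_eq_1_AE[OF \<open>prob_space M\<close>, of "orth_mats n"] by (simp add: M_def)
    fix Q assume Q: "Q \<in> orth_mats n"
    have "distr M (mat_space n) (mat_mult n Q) = distr P (mat_space n) (mat_mult n Q \<circ> gs_mat n)"
      unfolding M_def by (rule distr_distr) measurable
    \<comment> \<open>Equivariance moves \<open>Q\<close> from the output of Gram-Schmidt to its
      input, where \<open>P\<close> absorbs it.\<close>
    also have "mat_mult n Q \<circ> gs_mat n = gs_mat n \<circ> mat_mult n Q"
      by (auto simp: gs_mat_mat_mult[OF Q])
    also have "distr P (mat_space n) \<dots> = distr (distr P (mat_space n) (mat_mult n Q)) (mat_space n) (gs_mat n)"
      by (rule distr_distr[symmetric]) measurable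
    also have "\<dots> = M" by (simp add: P_inv[OF Q] M_def)
    finally show "distr M (mat_space n) (mat_mult n Q) = M" .
  qed
  then show ?thesis ..
qed

lemma is_haar_On_haar_On: "is_haar_On n (haar_On n)"
  unfolding haar_On_def by (rule someI_ex[OF haar_On_exists])

section \<open>Infinitesimal rotations\<close>

lemma prob_space_haar_On: "prob_space (haar_On n)"
  and sets_haar_On [measurable_cong]: "sets (haar_On n) = sets (mat_space n)"
  using is_haar_On_haar_On[of n] by (simp_all add: is_haar_On_def)

lemma AE_haar_On_orth: "AE U in haar_On n. U \<in> orth_mats n"
proof -
  interpret prob_space "haar_On n" by (rule prob_space_haar_On)
  show ?thesis
    using is_haar_On_haar_On[of n]
    by (subst AE_in_set_eq_1) (simp_all add: is_haar_On_def sets_haar_On sets_orth_mats measure_def)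
qed

lemma integrable_haar_On:
  assumes "f \<in> borel_measurable (mat_space n)" "\<And>U. U \<in> orth_mats n \<Longrightarrow> \<bar>f U\<bar> \<le> K"
  shows "integrable (haar_On n) (f :: _ \<Rightarrow> real)"
proof -
  interpret prob_space "haar_On n" by (rule prob_space_haar_On)
  show ?thesis
  proof (rule integrable_const_bound[of _ K])
    show "AE U in haar_On n. norm (f U) \<le> K" using AE_haar_On_orth[of n] assms(2) by auto
  qed (use assms(1) in measurable)
qed

lemma integral_haar_On_mat_mult:
  assumes "Q \<in> orth_mats n" and [measurable]: "f \<in> borel_measurable (mat_space n)"
  shows "(\<integral>U. f (mat_mult n Q U) \<partial>haar_On n) = (\<integral>U. f U \<partial>haar_On n :: real)"
proof -
  have "(\<integral>U. f U \<partial>haar_On n) = (\<integral>U. f U \<partial>distr (haar_On n) (mat_space n) (mat_mult n Q))"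
    using is_haar_On_haar_On[of n] assms(1) by (simp add: is_haar_On_def)
  also have "\<dots> = (\<integral>U. f (mat_mult n Q U) \<partial>haar_On n)"
    by (rule integral_distr) measurable
  finally show ?thesis ..
qed

text \<open>Rotation by the angle \<open>t\<close> in the plane of coordinates \<open>i\<close> and
  \<open>j\<close>. Its derivative at \<open>t = 0\<close> sends row \<open>i\<close> to minus row
  \<open>j\<close> and row \<open>j\<close> to row \<open>i\<close>, which fixes the signs in the
  recurrences.\<close>

definition givens :: "nat \<Rightarrow> nat \<Rightarrow> nat \<Rightarrow> real \<Rightarrow> (nat \<times> nat \<Rightarrow> real)" where
  "givens n i j t = restrict (\<lambda>(k, l).
     if k = i then cos t * (if l = i then 1 else 0) - sin t * (if l = j then 1 else 0)
     else if k = j then sin t * (if l = i then 1 else 0) + cos t * (if l = j then 1 else 0)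
     else if l = k then 1 else 0) ({..<n} \<times> {..<n})"

lemma sum_givens:
  assumes "i < n" "j < n" "i \<noteq> j" "k < n"
  shows "(\<Sum>l<n. givens n i j t (k, l) * x l) =
    (if k = i then cos t * x i - sin t * x j else if k = j then sin t * x i + cos t * x j else x k)"
proof -
  have delta: "(\<Sum>l<n. (if l = m then 1 else 0) * x l) = x m" if "m < n" for m
    using that by (simp add: if_distrib[of "\<lambda>t. t * _"] cong: if_cong)
  have "(\<Sum>l<n. givens n i j t (k, l) * x l) = (\<Sum>l<n.
      (if k = i then cos t * ((if l = i then 1 else 0) * x l) - sin t * ((if l = j then 1 else 0) * x l)
       else if k = j then sin t * ((if l = i then 1 else 0) * x l) + cos t * ((if l = j then 1 else 0) * x l)
       else (if l = k then 1 else 0) * x l))"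
    using assms by (intro sum.cong) (auto simp: givens_def)
  also have "\<dots> = (if k = i then cos t * x i - sin t * x j
      else if k = j then sin t * x i + cos t * x j else x k)"
    by (simp add: sum_subtractf sum.distrib delta assms flip: sum_distrib_left del: mult_if_delta)
  finally show ?thesis .
qed

lemma givens_orth:
  assumes "i < n" "j < n" "i \<noteq> j"
  shows "givens n i j t \<in> orth_mats n"
proof -
  have "(\<Sum>m<n. givens n i j t (k, m) * givens n i j t (l, m)) = (if k = l then 1 else 0)"
    if "k < n" "l < n" for k l
    unfolding sum_givens[OF assms that(1)] using assms that
    by (auto simp: givens_def simp flip: power2_eq_square)
  then show ?thesis by (auto simp: orth_mats_def space_mat_space givens_def)
qed

section \<open>Lipschitz estimates in the rotation angle\<close>

lemma abs_mult_diff_le: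
  fixes a b c d :: real
  assumes "\<bar>a\<bar> \<le> 1" "\<bar>d\<bar> \<le> 1"
  shows "\<bar>a * b - c * d\<bar> \<le> \<bar>a - c\<bar> + \<bar>b - d\<bar>"
proof -
  have "\<bar>a * b - c * d\<bar> = \<bar>(a - c) * d + a * (b - d)\<bar>" by (simp add: algebra_simps)
  also have "\<dots> \<le> \<bar>a - c\<bar> * \<bar>d\<bar> + \<bar>a\<bar> * \<bar>b - d\<bar>" by (metis abs_mult abs_triangle_ineq)
  also have "\<dots> \<le> \<bar>a - c\<bar> * 1 + 1 * \<bar>b - d\<bar>"
    using assms by (intro add_mono mult_mono) auto
  finally show ?thesis by simp
qed

lemma abs_power_diff_le:
  fixes a b :: real
  assumes "\<bar>a\<bar> \<le> 1" "\<bar>b\<bar> \<le> 1" "\<bar>a - b\<bar> \<le> d"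
  shows "\<bar>a ^ p - b ^ p\<bar> \<le> p * d"
  using norm_power_diff[of a b p] assms mult_left_mono[of "\<bar>a - b\<bar>" d "real p"] by simp

lemma abs_cos_minus_1_le: "\<bar>cos t - 1\<bar> \<le> \<bar>t :: real\<bar>"
proof -
  have "cos t - 1 = - 2 * (sin (t / 2) * sin (t / 2))"
    using cos_double_sin[of "t / 2"] by (simp add: power2_eq_square)
  then have "\<bar>cos t - 1\<bar> = 2 * (\<bar>sin (t / 2)\<bar> * \<bar>sin (t / 2)\<bar>)" by (simp add: abs_mult)
  also have "\<dots> \<le> 2 * (\<bar>t / 2\<bar> * 1)"
    by (intro mult_left_mono mult_mono abs_sin_x_le_abs_x) auto
  finally show ?thesis by simp
qed

text \<open>The constant 2 collects one \<open>\<bar>t\<bar>\<close> from \<open>cos t - 1\<close>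
  and one from \<open>sin t\<close>.\<close>

lemma abs_cos_sin_diff_le:
  fixes t x y :: real
  assumes "\<bar>x\<bar> \<le> 1" "\<bar>y\<bar> \<le> 1"
  shows "\<bar>(cos t * x - sin t * y) - x\<bar> \<le> 2 * \<bar>t\<bar>" "\<bar>(sin t * x + cos t * y) - y\<bar> \<le> 2 * \<bar>t\<bar>"
proof -
  have c: "\<bar>(cos t - 1) * z\<bar> \<le> \<bar>t\<bar>" "\<bar>sin t * z\<bar> \<le> \<bar>t\<bar>" if "\<bar>z\<bar> \<le> 1" for z
    using mult_mono[OF abs_cos_minus_1_le[of t] that] mult_mono[OF abs_sin_x_le_abs_x[of t] that]
    by (simp_all add: abs_mult)
  show "\<bar>(cos t * x - sin t * y) - x\<bar> \<le> 2 * \<bar>t\<bar>"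
    using c(1)[OF assms(1)] c(2)[OF assms(2)] by (simp add: algebra_simps abs_le_iff)
  show "\<bar>(sin t * x + cos t * y) - y\<bar> \<le> 2 * \<bar>t\<bar>"
    using c(2)[OF assms(1)] c(1)[OF assms(2)] by (simp add: algebra_simps abs_le_iff)
qed

text \<open>Invariance under the rotations of rows \<open>i\<close> and \<open>j\<close>, differentiated at angle zero.\<close>
lemma haar_On_infinitesimal_rotation:
  assumes "i < n" "j < n" "i \<noteq> j" "u < n" "v < n" "k < n" "w < n" "k \<noteq> i" "k \<noteq> j \<or> e = 0"
  shows "has_bochner_integral (haar_On n) (\<lambda>U.
    (real q * U (i, u) ^ (p + 1) * U (j, u) ^ (q - 1) * U (i, v) ^ r
     - real p * U (i, u) ^ (p - 1) * U (j, u) ^ (q + 1) * U (i, v) ^ r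
     - real r * U (i, u) ^ p * U (j, u) ^ q * U (i, v) ^ (r - 1) * U (j, v)) * U (k, w) ^ e) 0"
    (is "has_bochner_integral _ ?D 0")
proof -
  \<comment> \<open>The monomial to be differentiated. Its last factor is fixed by the rotation:
    \<open>k\<close> is a third row unless \<open>e = 0\<close>. In the derivative
    \<open>?D\<close>, a truncated exponent such as \<open>q - 1\<close> at \<open>q = 0\<close>
    comes with the coefficient 0.\<close>
  define f where "f U = U (i, u) ^ p * (U (j, u) ^ q * U (i, v) ^ r) * U (k, w) ^ e"
    for U :: "nat \<times> nat \<Rightarrow> real"
  define F where "F t U = f (mat_mult n (givens n i j t) U)" for t U
  define A where "A t U = cos t * U (i, u) - sin t * U (j, u)" for t and U :: "nat \<times> nat \<Rightarrow> real"
  define B where "B t U = sin t * U (i, u) + cos t * U (j, u)" for t and U :: "nat \<times> nat \<Rightarrow> real"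
  define C where "C t U = cos t * U (i, v) - sin t * U (j, v)" for t and U :: "nat \<times> nat \<Rightarrow> real"
  \<comment> \<open>Nonzero increments tending to 0, so that dominated convergence for sequences
    applies to the difference quotients.\<close>
  define h where "h m = inverse (real (Suc m))" for m
  have [measurable]: "f \<in> borel_measurable (mat_space n)"
    unfolding f_def using assms by measurable
  have [measurable]: "F t \<in> borel_measurable (mat_space n)" for t
    unfolding F_def by measurable
  have F_eq: "F t U = A t U ^ p * (B t U ^ q * C t U ^ r) * U (k, w) ^ e" for t U
    using assms by (auto simp: F_def f_def A_def B_def C_def mat_mult_apply sum_givens)
  have entries: "\<bar>A t U\<bar> \<le> 1" "\<bar>B t U\<bar> \<le> 1" "\<bar>C t U\<bar> \<le> 1" if "U \<in> orth_mats n" for t U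
  proof -
    have "mat_mult n (givens n i j t) U \<in> orth_mats n"
      using that assms by (subst mat_mult_orth_iff) (auto intro: givens_orth orth_mats_space)
    from orth_mats_abs_le_1[OF this] assms show "\<bar>A t U\<bar> \<le> 1" "\<bar>B t U\<bar> \<le> 1" "\<bar>C t U\<bar> \<le> 1"
      by (force simp: A_def B_def C_def mat_mult_apply sum_givens)+
  qed
  have power_le: "\<bar>x ^ m\<bar> \<le> 1" if "\<bar>x\<bar> \<le> 1" for x :: real and m
    using that by (simp add: power_abs power_le_one)
  have mult_le: "\<bar>x * y\<bar> \<le> 1" if "\<bar>x\<bar> \<le> 1" "\<bar>y\<bar> \<le> 1" for x y :: real
    using mult_mono[OF that] by (simp add: abs_mult)
  have bound: "\<bar>F t U\<bar> \<le> 1" if "U \<in> orth_mats n" for t U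
    unfolding F_eq by (intro mult_le power_le entries orth_mats_abs_le_1[OF that] that assms)
  \<comment> \<open>A rotated entry moves by at most \<open>2 * \<bar>t\<bar>\<close>, hence its
    \<open>p\<close>-th power by \<open>p * 2 * \<bar>t\<bar>\<close>. The sum over the three moving
    factors is a Lipschitz constant in \<open>t\<close> and the dominating constant for the
    difference quotients.\<close>
  define K where "K = p * 2 + (q * 2 + r * 2 :: real)"
  have lipschitz: "\<bar>F t U - F 0 U\<bar> \<le> K * \<bar>t\<bar>" if U: "U \<in> orth_mats n" for t U
  proof -
    note le1 = orth_mats_abs_le_1[OF U]
    have "\<bar>A t U - A 0 U\<bar> \<le> 2 * \<bar>t\<bar>" "\<bar>B t U - B 0 U\<bar> \<le> 2 * \<bar>t\<bar>" "\<bar>C t U - C 0 U\<bar> \<le> 2 * \<bar>t\<bar>"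
      using assms abs_cos_sin_diff_le[OF le1[of i u] le1[of j u], of t]
        abs_cos_sin_diff_le[OF le1[of i v] le1[of j v], of t]
      by (simp_all add: A_def B_def C_def)
    note d = abs_power_diff_le[OF entries(1)[OF U] entries(1)[OF U] this(1), of p]
      abs_power_diff_le[OF entries(2)[OF U] entries(2)[OF U] this(2), of q]
      abs_power_diff_le[OF entries(3)[OF U] entries(3)[OF U] this(3), of r]
    have "\<bar>F t U - F 0 U\<bar> =
        \<bar>A t U ^ p * (B t U ^ q * C t U ^ r) - A 0 U ^ p * (B 0 U ^ q * C 0 U ^ r)\<bar> * \<bar>U (k, w) ^ e\<bar>"
      by (simp add: F_eq flip: left_diff_distrib abs_mult)
    also have "\<dots> \<le> \<bar>A t U ^ p * (B t U ^ q * C t U ^ r) - A 0 U ^ p * (B 0 U ^ q * C 0 U ^ r)\<bar> * 1"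
      using assms by (intro mult_left_mono power_le le1) auto
    also have "\<dots> \<le> \<bar>A t U ^ p - A 0 U ^ p\<bar> + \<bar>B t U ^ q * C t U ^ r - B 0 U ^ q * C 0 U ^ r\<bar>"
      unfolding mult_1_right by (intro abs_mult_diff_le power_le mult_le entries U)
    also have "\<dots> \<le> \<bar>A t U ^ p - A 0 U ^ p\<bar> + (\<bar>B t U ^ q - B 0 U ^ q\<bar> + \<bar>C t U ^ r - C 0 U ^ r\<bar>)"
      by (intro add_left_mono abs_mult_diff_le power_le mult_le entries U)
    also have "\<dots> \<le> K * \<bar>t\<bar>" using d by (simp add: K_def algebra_simps)
    finally show ?thesis .
  qed
  have deriv: "((\<lambda>t. F t U) has_real_derivative ?D U) (at 0)" for U
    unfolding F_eq A_def B_def C_def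
    by (auto intro!: derivative_eq_intros simp: algebra_simps)
  have h_pos: "h m > 0" for m by (simp add: h_def)
  have h_lim: "filterlim h (at 0) sequentially"
    unfolding filterlim_at using LIMSEQ_inverse_real_of_nat by (simp add: h_def[abs_def])
  have lim: "(\<lambda>m. (F (h m) U - F 0 U) / h m) \<longlonglongrightarrow> ?D U" for U
  proof -
    have "(\<lambda>t. (F (0 + t) U - F 0 U) / t) \<midarrow>0\<rightarrow> ?D U"
      using deriv[of U] unfolding DERIV_def .
    from filterlim_compose[OF this h_lim] show ?thesis by simp
  qed
  have D_meas [measurable]: "?D \<in> borel_measurable (haar_On n)"
    using assms by measurable
  have Fh_meas: "(\<lambda>U. (F (h m) U - F 0 U) / h m) \<in> borel_measurable (haar_On n)" for m by measurable
  interpret prob_space "haar_On n" by (rule prob_space_haar_On)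
  have Fh_bound: "AE U in haar_On n. norm ((F (h m) U - F 0 U) / h m) \<le> K" for m
  proof -
    have "norm ((F (h m) U - F 0 U) / h m) \<le> K" if "U \<in> orth_mats n" for U
      using lipschitz[OF that, of "h m"] h_pos[of m] by (simp add: pos_divide_le_eq)
    then show ?thesis using AE_haar_On_orth[of n] by auto
  qed
  have F_int: "integrable (haar_On n) (F t)" for t
    by (rule integrable_haar_On[of _ _ 1]) (use bound in auto)
  \<comment> \<open>By invariance the mean of \<open>F t\<close> does not depend on
    \<open>t\<close>, so all difference quotients have mean zero.\<close>
  have "(\<integral>U. F t U \<partial>haar_On n) = (\<integral>U. f U \<partial>haar_On n)" for t
    unfolding F_def using assms by (intro integral_haar_On_mat_mult givens_orth) auto
  then have zero: "(\<integral>U. (F (h m) U - F 0 U) / h m \<partial>haar_On n) = 0" for m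
    using F_int by simp
  have "(\<lambda>m. \<integral>U. (F (h m) U - F 0 U) / h m \<partial>haar_On n) \<longlonglongrightarrow> (\<integral>U. ?D U \<partial>haar_On n)"
    by (rule integral_dominated_convergence[where w = "\<lambda>_. K" and s = "\<lambda>m U. (F (h m) U - F 0 U) / h m"])
      (use D_meas Fh_meas Fh_bound lim in auto)
  then have "(\<integral>U. ?D U \<partial>haar_On n) = 0"
    unfolding zero by (simp add: LIMSEQ_const_iff)
  moreover have "integrable (haar_On n) ?D"
    by (rule integrable_dominated_convergence[where w = "\<lambda>_. K" and s = "\<lambda>m U. (F (h m) U - F 0 U) / h m"])
      (use D_meas Fh_meas Fh_bound lim in auto)
  ultimately show ?thesis by (simp add: has_bochner_integral_iff)
qed

section \<open>Recurrences for the moments\<close>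

text \<open>This is \<open>F(a,b,c)\<close>, with column 0 as \<open>x\<close> and column 1 as
  \<open>y\<close>.\<close>

definition moment :: "nat \<Rightarrow> nat \<Rightarrow> nat \<Rightarrow> nat \<Rightarrow> real" where
  "moment n a b c = (\<integral>U. U (0, 0) ^ a * U (1, 0) ^ b * U (0, 1) ^ c \<partial>haar_On n)"

lemma has_bochner_integral_moment:
  assumes "n \<ge> 2"
  shows "has_bochner_integral (haar_On n) (\<lambda>U. U (0, 0) ^ a * U (1, 0) ^ b * U (0, 1) ^ c) (moment n a b c)"
proof -
  have "integrable (haar_On n) (\<lambda>U. U (0, 0) ^ a * U (1, 0) ^ b * U (0, 1) ^ c)"
  proof (rule integrable_haar_On[of _ _ "1 * 1 * 1"])
    fix U assume U: "U \<in> orth_mats n"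
    show "\<bar>U (0, 0) ^ a * U (1, 0) ^ b * U (0, 1) ^ c\<bar> \<le> 1 * 1 * 1"
      unfolding abs_mult power_abs using assms
      by (intro mult_mono power_le_one orth_mats_abs_le_1[OF U]) auto
  qed (use assms in \<open>auto intro!: borel_measurable_times borel_measurable_power measurable_mat_entry\<close>)
  then show ?thesis by (simp add: has_bochner_integral_iff moment_def)
qed

lemma moment_0: "moment n 0 0 0 = 1"
proof -
  interpret prob_space "haar_On n" by (rule prob_space_haar_On)
  show ?thesis by (simp add: moment_def prob_space)
qed

text \<open>The relations between columns hold only on orthogonal matrices, hence almost everywhere.
  That suffices to compare the mean of the sum, which is zero, with the mean \<open>x\<close> of
  \<open>g\<close>.\<close>

lemma haar_On_sum_eq_zeroI:
  assumes T: "\<And>k. k \<in> K \<Longrightarrow> has_bochner_integral (haar_On n) (T k) 0"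
    and g: "has_bochner_integral (haar_On n) g (x :: real)"
    and eq: "\<And>U. U \<in> orth_mats n \<Longrightarrow> (\<Sum>k\<in>K. T k U) = g U"
  shows "x = 0"
proof -
  have f: "has_bochner_integral (haar_On n) (\<lambda>U. \<Sum>k\<in>K. T k U) (\<Sum>k\<in>K. 0)"
    by (intro has_bochner_integral_sum T)
  have "(\<integral>U. (\<Sum>k\<in>K. T k U) \<partial>haar_On n) = integral\<^sup>L (haar_On n) g"
    using f g eq AE_haar_On_orth[of n]
    by (intro integral_cong_AE) (auto simp: has_bochner_integral_iff)
  then show ?thesis using f g by (simp add: has_bochner_integral_iff)
qed

lemma sum_lessThan_split_first:
  "n > 0 \<Longrightarrow> (\<Sum>k<n. f k) = f 0 + (\<Sum>k=1..<n. f k :: real)" for n :: nat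
  unfolding lessThan_atLeast0 by (subst sum.atLeast_Suc_lessThan) simp_all

lemma moment_rec_a:
  assumes n: "n \<ge> 2"
  shows "real (a + b + c + n) * moment n (a + 2) b c = real (a + 1) * moment n a b c"
proof -
  \<comment> \<open>The rotation identity for rows 0 and \<open>k\<close> applied to
    \<open>x_0^(a+1) x_1^b y_0^c x_k\<close>. For \<open>k = 1\<close> the factors
    \<open>x_1^b\<close> and \<open>x_k\<close> merge, and differentiating \<open>x_1^(b+1)\<close>
    produces the weight \<open>b + 1\<close>.\<close>
  define T where "T k U =
      (if k = 1 then real b + 1 else 1) * (U (0, 0) ^ (a + 2) * U (1, 0) ^ b * U (0, 1) ^ c)
      - real (a + 1) * (U (0, 0) ^ a * U (1, 0) ^ b * U (0, 1) ^ c) * (U (k, 0) * U (k, 0))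
      - real c * U (0, 0) ^ (a + 1) * U (1, 0) ^ b * U (0, 1) ^ (c - 1) * (U (k, 0) * U (k, 1))"
    for k and U :: "nat \<times> nat \<Rightarrow> real"
  have T: "has_bochner_integral (haar_On n) (T k) 0" if "k \<in> {1..<n}" for k
  proof (cases "k = 1")
    case True
    \<comment> \<open>The power of \<open>x_1\<close> now belongs to a rotated row, so the fixed
      factor is the empty power \<open>U (1, 0) ^ 0\<close>.\<close>
    have "T 1 = (\<lambda>U. (real (b + 1) * U (0, 0) ^ (a + 1 + 1) * U (1, 0) ^ (b + 1 - 1) * U (0, 1) ^ c
        - real (a + 1) * U (0, 0) ^ (a + 1 - 1) * U (1, 0) ^ (b + 1 + 1) * U (0, 1) ^ c
        - real c * U (0, 0) ^ (a + 1) * U (1, 0) ^ (b + 1) * U (0, 1) ^ (c - 1) * U (1, 1)) * U (1, 0) ^ 0)"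
      by (simp add: T_def fun_eq_iff algebra_simps)
    then show ?thesis unfolding True
      using haar_On_infinitesimal_rotation[of 0 n 1 0 1 1 0 0 "b + 1" "a + 1" c] n by simp
  next
    case False
    have "T k = (\<lambda>U. (real 1 * U (0, 0) ^ (a + 1 + 1) * U (k, 0) ^ (1 - 1) * U (0, 1) ^ c
        - real (a + 1) * U (0, 0) ^ (a + 1 - 1) * U (k, 0) ^ (1 + 1) * U (0, 1) ^ c
        - real c * U (0, 0) ^ (a + 1) * U (k, 0) ^ 1 * U (0, 1) ^ (c - 1) * U (k, 1)) * U (1, 0) ^ b)"
      using False by (simp add: T_def fun_eq_iff algebra_simps)
    then show ?thesis
      using haar_On_infinitesimal_rotation[of 0 n k 0 1 1 0 b 1 "a + 1" c] n that False by simp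
  qed
  have g: "has_bochner_integral (haar_On n)
      (\<lambda>U. real (a + b + c + n) * (U (0, 0) ^ (a + 2) * U (1, 0) ^ b * U (0, 1) ^ c)
        - real (a + 1) * (U (0, 0) ^ a * U (1, 0) ^ b * U (0, 1) ^ c))
      (real (a + b + c + n) * moment n (a + 2) b c - real (a + 1) * moment n a b c)"
    by (intro has_bochner_integral_diff has_bochner_integral_mult_right has_bochner_integral_moment n)
  have "(\<Sum>k=1..<n. T k U) = real (a + b + c + n) * (U (0, 0) ^ (a + 2) * U (1, 0) ^ b * U (0, 1) ^ c)
        - real (a + 1) * (U (0, 0) ^ a * U (1, 0) ^ b * U (0, 1) ^ c)" if U: "U \<in> orth_mats n" for U
  proof -
    have xx: "(\<Sum>k=1..<n. U (k, 0) * U (k, 0)) = 1 - U (0, 0) * U (0, 0)"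
      using orth_mats_cols[OF U, of 0 0] sum_lessThan_split_first[of n "\<lambda>k. U (k, 0) * U (k, 0)"] n by simp
    have xy: "(\<Sum>k=1..<n. U (k, 0) * U (k, 1)) = - (U (0, 0) * U (0, 1))"
      using orth_mats_cols[OF U, of 0 1] sum_lessThan_split_first[of n "\<lambda>k. U (k, 0) * U (k, 1)"] n by simp
    have w: "(\<Sum>k=1..<n. if k = 1 then real b + 1 else 1) = real (n - 1 + b)"
    proof -
      have "(\<Sum>k=1..<n. if k = 1 then real b + 1 else 1) = (\<Sum>k=1..<n. (if k = 1 then real b else 0) + 1)"
        by (intro sum.cong) auto
      then show ?thesis using n by (simp add: sum.distrib)
    qed
    have "(\<Sum>k=1..<n. T k U) =
        real (n - 1 + b) * (U (0, 0) ^ (a + 2) * U (1, 0) ^ b * U (0, 1) ^ c)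
        - real (a + 1) * (U (0, 0) ^ a * U (1, 0) ^ b * U (0, 1) ^ c) * (1 - U (0, 0) * U (0, 0))
        - real c * U (0, 0) ^ (a + 1) * U (1, 0) ^ b * U (0, 1) ^ (c - 1) * (- (U (0, 0) * U (0, 1)))"
      unfolding T_def sum_subtractf w[symmetric] xx[symmetric] xy[symmetric]
      by (simp only: sum_distrib_left sum_distrib_right)
    also have "real c * U (0, 0) ^ (a + 1) * U (1, 0) ^ b * U (0, 1) ^ (c - 1) * (- (U (0, 0) * U (0, 1))) =
        - real c * (U (0, 0) ^ (a + 2) * U (1, 0) ^ b * U (0, 1) ^ c)"
      \<comment> \<open>For \<open>c = 0\<close> the exponent \<open>c - 1\<close> is truncated, but
        the coefficient \<open>c\<close> vanishes.\<close>
      by (cases c) (simp_all add: algebra_simps)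
    finally show ?thesis using n by (simp add: algebra_simps of_nat_diff)
  qed
  with T g have "real (a + b + c + n) * moment n (a + 2) b c - real (a + 1) * moment n a b c = 0"
    by (rule haar_On_sum_eq_zeroI)
  then show ?thesis by simp
qed

text \<open>Rows 1 and \<open>k\<close> with \<open>k \<ge> 2\<close> are rotated on
  \<open>x_1^(b+1) x_k y_0^c\<close>, so that row 0 and with it \<open>y_0^c\<close> stay fixed.
  Since the sum omits row 0, the relation \<open>|x| = 1\<close> leaves a term with
  \<open>x_0^2\<close>, the moment with \<open>a = 2\<close>. For \<open>n = 2\<close> the sum is
  empty and only \<open>x_0^2 + x_1^2 = 1\<close> remains.\<close>

lemma moment_rec_b:
  assumes n: "n \<ge> 2"
  shows "real (n + b - 1) * moment n 0 (b + 2) c = real (b + 1) * (moment n 0 b c - moment n 2 b c)"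
proof -
  define T where "T k U = U (1, 0) ^ (b + 2) * U (0, 1) ^ c
      - real (b + 1) * U (1, 0) ^ b * U (0, 1) ^ c * (U (k, 0) * U (k, 0))"
    for k and U :: "nat \<times> nat \<Rightarrow> real"
  have T: "has_bochner_integral (haar_On n) (T k) 0" if "k \<in> {2..<n}" for k
  proof -
    have "T k = (\<lambda>U. (real 1 * U (1, 0) ^ (b + 1 + 1) * U (k, 0) ^ (1 - 1) * U (1, 0) ^ 0
        - real (b + 1) * U (1, 0) ^ (b + 1 - 1) * U (k, 0) ^ (1 + 1) * U (1, 0) ^ 0
        - real 0 * U (1, 0) ^ (b + 1) * U (k, 0) ^ 1 * U (1, 0) ^ (0 - 1) * U (k, 0)) * U (0, 1) ^ c)"
      by (simp add: T_def fun_eq_iff algebra_simps)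
    then show ?thesis
      using haar_On_infinitesimal_rotation[of 1 n k 0 0 0 1 c 1 "b + 1" 0] n that by simp
  qed
  have g: "has_bochner_integral (haar_On n)
      (\<lambda>U. real (n + b - 1) * (U (0, 0) ^ 0 * U (1, 0) ^ (b + 2) * U (0, 1) ^ c)
        - real (b + 1) * (U (0, 0) ^ 0 * U (1, 0) ^ b * U (0, 1) ^ c - U (0, 0) ^ 2 * U (1, 0) ^ b * U (0, 1) ^ c))
      (real (n + b - 1) * moment n 0 (b + 2) c - real (b + 1) * (moment n 0 b c - moment n 2 b c))"
    by (intro has_bochner_integral_diff has_bochner_integral_mult_right has_bochner_integral_moment n)
  have "(\<Sum>k=2..<n. T k U) = real (n + b - 1) * (U (0, 0) ^ 0 * U (1, 0) ^ (b + 2) * U (0, 1) ^ c)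
        - real (b + 1) * (U (0, 0) ^ 0 * U (1, 0) ^ b * U (0, 1) ^ c - U (0, 0) ^ 2 * U (1, 0) ^ b * U (0, 1) ^ c)"
    if U: "U \<in> orth_mats n" for U
  proof -
    have "(\<Sum>k=1..<n. U (k, 0) * U (k, 0)) = U (1, 0) * U (1, 0) + (\<Sum>k=2..<n. U (k, 0) * U (k, 0))"
      using n by (simp add: sum.atLeast_Suc_lessThan numeral_2_eq_2)
    then have xx: "(\<Sum>k=2..<n. U (k, 0) * U (k, 0)) = 1 - U (0, 0) * U (0, 0) - U (1, 0) * U (1, 0)"
      using orth_mats_cols[OF U, of 0 0] sum_lessThan_split_first[of n "\<lambda>k. U (k, 0) * U (k, 0)"] n by simp
    have "(\<Sum>k=2..<n. T k U) = real (n - 2) * (U (1, 0) ^ (b + 2) * U (0, 1) ^ c)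
        - real (b + 1) * U (1, 0) ^ b * U (0, 1) ^ c * (1 - U (0, 0) * U (0, 0) - U (1, 0) * U (1, 0))"
      unfolding T_def sum_subtractf xx[symmetric] by (simp add: sum_distrib_left)
    then show ?thesis using n by (simp add: algebra_simps of_nat_diff power2_eq_square)
  qed
  with T g have "real (n + b - 1) * moment n 0 (b + 2) c
      - real (b + 1) * (moment n 0 b c - moment n 2 b c) = 0"
    by (rule haar_On_sum_eq_zeroI)
  then show ?thesis by simp
qed

text \<open>The argument of \<open>moment_rec_a\<close> for column 1 alone: rows 0 and
  \<open>k\<close> are rotated on \<open>y_0^(c+1) y_k\<close>, and \<open>|y| = 1\<close> evaluates
  the sum over \<open>k\<close>.\<close>

lemma moment_rec_c:
  assumes n: "n \<ge> 2"
  shows "real (c + n) * moment n 0 0 (c + 2) = real (c + 1) * moment n 0 0 c"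
proof -
  define T where "T k U = U (0, 1) ^ (c + 2) - real (c + 1) * U (0, 1) ^ c * (U (k, 1) * U (k, 1))"
    for k and U :: "nat \<times> nat \<Rightarrow> real"
  have T: "has_bochner_integral (haar_On n) (T k) 0" if "k \<in> {1..<n}" for k
  proof -
    have "T k = (\<lambda>U. (real 1 * U (0, 1) ^ (c + 1 + 1) * U (k, 1) ^ (1 - 1) * U (0, 1) ^ 0
        - real (c + 1) * U (0, 1) ^ (c + 1 - 1) * U (k, 1) ^ (1 + 1) * U (0, 1) ^ 0
        - real 0 * U (0, 1) ^ (c + 1) * U (k, 1) ^ 1 * U (0, 1) ^ (0 - 1) * U (k, 1)) * U (1, 1) ^ 0)"
      by (simp add: T_def fun_eq_iff algebra_simps)
    then show ?thesis
      using haar_On_infinitesimal_rotation[of 0 n k 1 1 1 1 0 1 "c + 1" 0] n that by simp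
  qed
  have g: "has_bochner_integral (haar_On n)
      (\<lambda>U. real (c + n) * (U (0, 0) ^ 0 * U (1, 0) ^ 0 * U (0, 1) ^ (c + 2))
        - real (c + 1) * (U (0, 0) ^ 0 * U (1, 0) ^ 0 * U (0, 1) ^ c))
      (real (c + n) * moment n 0 0 (c + 2) - real (c + 1) * moment n 0 0 c)"
    by (intro has_bochner_integral_diff has_bochner_integral_mult_right has_bochner_integral_moment n)
  have "(\<Sum>k=1..<n. T k U) = real (c + n) * (U (0, 0) ^ 0 * U (1, 0) ^ 0 * U (0, 1) ^ (c + 2))
        - real (c + 1) * (U (0, 0) ^ 0 * U (1, 0) ^ 0 * U (0, 1) ^ c)"
    if U: "U \<in> orth_mats n" for U
  proof -
    have yy: "(\<Sum>k=1..<n. U (k, 1) * U (k, 1)) = 1 - U (0, 1) * U (0, 1)"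
      using orth_mats_cols[OF U, of 1 1] sum_lessThan_split_first[of n "\<lambda>k. U (k, 1) * U (k, 1)"] n by simp
    have "(\<Sum>k=1..<n. T k U) = real (n - 1) * U (0, 1) ^ (c + 2)
        - real (c + 1) * U (0, 1) ^ c * (1 - U (0, 1) * U (0, 1))"
      unfolding T_def sum_subtractf yy[symmetric] by (simp add: sum_distrib_left)
    then show ?thesis using n by (simp add: algebra_simps of_nat_diff)
  qed
  with T g have "real (c + n) * moment n 0 0 (c + 2) - real (c + 1) * moment n 0 0 c = 0"
    by (rule haar_On_sum_eq_zeroI)
  then show ?thesis by simp
qed

section \<open>Closed form of the even moments\<close>

lemma dfact_0: "dfact 0 = 1"
  by (simp add: dfact_def)

text \<open>The largest admissible factor rises from \<open>m - 1\<close> to \<open>m + 1\<close>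
  with the same parity, so \<open>m + 1\<close> is the only new factor.\<close>

lemma dfact_add_2: "dfact (m + 2) = real (m + 1) * dfact m"
proof -
  have "{k. 1 \<le> k \<and> k + 1 \<le> m + 2 \<and> even (m + 2 - 1 - k)} =
      insert (m + 1) {k. 1 \<le> k \<and> k + 1 \<le> m \<and> even (m - 1 - k)}" (is "?A = insert _ ?B")
  proof (rule Set.set_eqI)
    fix k
    \<comment> \<open>The split controls the truncated subtraction: \<open>k = m\<close> lies in the
      larger range but fails the parity test.\<close>
    consider "k + 1 \<le> m" | "k = m" | "k = m + 1" | "k > m + 1" by linarith
    then show "k \<in> ?A \<longleftrightarrow> k \<in> insert (m + 1) ?B"
    proof cases
      case 1
      then have "m + 2 - 1 - k = (m - 1 - k) + 2" by simp
      with 1 show ?thesis by auto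
    qed auto
  qed
  moreover have "finite ?B" by (rule finite_subset[of _ "{..m}"]) auto
  moreover have "m + 1 \<notin> ?B" by simp
  ultimately show ?thesis by (simp add: dfact_def distrib_right)
qed

lemma dfact_pos: "dfact m > 0"
  unfolding dfact_def of_nat_0_less_iff by (rule prod_pos) auto

lemma dfact_nonzero [simp]: "dfact m \<noteq> 0"
  using dfact_pos[of m] by simp

text \<open>Writing the dimension as \<open>m + 2\<close> turns \<open>n - 2\<close> and
  \<open>n - 1\<close> into \<open>m\<close> and \<open>m + 1\<close> and avoids truncated
  subtraction in the inductions.\<close>

lemma moment_even_c: "moment (m + 2) 0 0 (2 * c) = dfact (m + 1) * dfact (2 * c) / dfact (2 * c + m + 1)"
proof (induction c)
  case (Suc c)
  define s where "s = real (2 * c + m + 2)"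
  have s: "s > 0" by (simp add: s_def)
  have "s * moment (m + 2) 0 0 (2 * c + 2) = real (2 * c + 1) * moment (m + 2) 0 0 (2 * c)"
    using moment_rec_c[of "m + 2" "2 * c"] by (simp add: s_def add.assoc)
  then have "moment (m + 2) 0 0 (2 * c + 2) = real (2 * c + 1) / s * moment (m + 2) 0 0 (2 * c)"
    using s by (simp add: field_simps del: of_nat_add)
  moreover have "dfact (2 * c + 2) = real (2 * c + 1) * dfact (2 * c)" by (rule dfact_add_2)
  moreover have "dfact (2 * c + 2 + m + 1) = s * dfact (2 * c + m + 1)"
    using dfact_add_2[of "2 * c + m + 1"] by (simp add: s_def algebra_simps)
  moreover have "2 * Suc c = 2 * c + 2" by simp
  ultimately show ?case
    using s by (simp only: Suc.IH) (simp add: field_simps del: of_nat_add)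
qed (simp add: moment_0 dfact_0)

text \<open>Induction on \<open>b\<close>. The unwanted moment with \<open>a = 2\<close> in
  \<open>moment_rec_b\<close> is eliminated by \<open>moment_rec_a\<close> at \<open>a = 0\<close>,
  which closes the recurrence within the moments with \<open>a = 0\<close>.\<close>

lemma moment_even_bc:
  "moment (m + 2) 0 (2 * b) (2 * c) =
    dfact (m + 1) * dfact m * dfact (2 * b) * dfact (2 * c) * dfact (2 * b + 2 * c + m) /
    (dfact (2 * b + m) * dfact (2 * c + m) * dfact (2 * b + 2 * c + m + 1))"
proof (induction b)
  case 0
  then show ?case using moment_even_c[of m c] by (simp add: dfact_0)
next
  case (Suc b)
  \<comment> \<open>\<open>s\<close> and, below, \<open>t\<close> are the left-hand coefficients of
    \<open>moment_rec_a\<close> and \<open>moment_rec_b\<close> in dimension \<open>m + 2\<close>.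
    The difference \<open>1 - 1 / s\<close> contributes the factor \<open>s - 1\<close> that
    advances \<open>dfact (2 * b + 2 * c + m)\<close>.\<close>
  define s where "s = real (2 * b + 2 * c + m + 2)"
  define t where "t = real (2 * b + m + 1)"
  have s: "s > 0" and t: "t > 0" by (simp_all add: s_def t_def)
  have "s * moment (m + 2) 2 (2 * b) (2 * c) = moment (m + 2) 0 (2 * b) (2 * c)"
    using moment_rec_a[of "m + 2" 0 "2 * b" "2 * c", unfolded add_0_left] by (simp add: s_def add.assoc)
  then have 2: "moment (m + 2) 2 (2 * b) (2 * c) = moment (m + 2) 0 (2 * b) (2 * c) / s"
    using s by (simp add: field_simps)
  have "t * moment (m + 2) 0 (2 * b + 2) (2 * c) =
      real (2 * b + 1) * (moment (m + 2) 0 (2 * b) (2 * c) - moment (m + 2) 0 (2 * b) (2 * c) / s)"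
    using moment_rec_b[of "m + 2" "2 * b" "2 * c"] unfolding 2 by (simp add: t_def algebra_simps)
  also have "moment (m + 2) 0 (2 * b) (2 * c) - moment (m + 2) 0 (2 * b) (2 * c) / s =
      (s - 1) / s * moment (m + 2) 0 (2 * b) (2 * c)"
    using s by (simp add: field_simps)
  finally have "moment (m + 2) 0 (2 * b + 2) (2 * c) =
      real (2 * b + 1) * (s - 1) / (t * s) * moment (m + 2) 0 (2 * b) (2 * c)"
    using s t by (simp add: field_simps del: of_nat_add)
  moreover have "dfact (2 * b + 2) = real (2 * b + 1) * dfact (2 * b)" by (rule dfact_add_2)
  moreover have "dfact (2 * b + 2 + 2 * c + m) = (s - 1) * dfact (2 * b + 2 * c + m)"
    using dfact_add_2[of "2 * b + 2 * c + m"] by (simp add: s_def algebra_simps)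
  moreover have "dfact (2 * b + 2 + m) = t * dfact (2 * b + m)"
    using dfact_add_2[of "2 * b + m"] by (simp add: t_def algebra_simps)
  moreover have "dfact (2 * b + 2 + 2 * c + m + 1) = s * dfact (2 * b + 2 * c + m + 1)"
    using dfact_add_2[of "2 * b + 2 * c + m + 1"] by (simp add: s_def algebra_simps)
  moreover have "2 * Suc b = 2 * b + 2" by simp
  ultimately show ?case
    using s t by (simp only: Suc.IH) (simp add: field_simps del: of_nat_add)
qed

lemma moment_even:
  "moment (m + 2) (2 * a) (2 * b) (2 * c) =
    dfact (m + 1) * dfact m * dfact (2 * a) * dfact (2 * b) * dfact (2 * c) * dfact (2 * b + 2 * c + m) /
    (dfact (2 * b + m) * dfact (2 * c + m) * dfact (2 * a + 2 * b + 2 * c + m + 1))"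
proof (induction a)
  case 0
  then show ?case using moment_even_bc[of m b c] by (simp add: dfact_0)
next
  case (Suc a)
  define s where "s = real (2 * a + 2 * b + 2 * c + m + 2)"
  have s: "s > 0" by (simp add: s_def)
  have "s * moment (m + 2) (2 * a + 2) (2 * b) (2 * c) = real (2 * a + 1) * moment (m + 2) (2 * a) (2 * b) (2 * c)"
    using moment_rec_a[of "m + 2" "2 * a" "2 * b" "2 * c"] by (simp add: s_def add.assoc)
  then have "moment (m + 2) (2 * a + 2) (2 * b) (2 * c) = real (2 * a + 1) / s * moment (m + 2) (2 * a) (2 * b) (2 * c)"
    using s by (simp add: field_simps del: of_nat_add)
  moreover have "dfact (2 * a + 2) = real (2 * a + 1) * dfact (2 * a)" by (rule dfact_add_2)
  moreover have "dfact (2 * a + 2 + 2 * b + 2 * c + m + 1) = s * dfact (2 * a + 2 * b + 2 * c + m + 1)"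
    using dfact_add_2[of "2 * a + 2 * b + 2 * c + m + 1"] by (simp add: s_def algebra_simps)
  moreover have "2 * Suc a = 2 * a + 2" by simp
  ultimately show ?case
    using s by (simp only: Suc.IH) (simp add: field_simps del: of_nat_add)
qed

theorem theorem4p3:
  fixes a b c n :: nat
  assumes "even a" and "even b" and "even c" and "n \<ge> 2"
  shows "Phi_n n [a, c] [b, 0] =
    dfact (n - 1) / dfact (n - 2) *
    (dfact (a + c + n - 2) * dfact (b + c + n - 2) /
     (dfact (c + n - 2) * dfact (a + b + c + n - 1)))"
proof -
  obtain a' b' c' m where eqs: "a = 2 * a'" "b = 2 * b'" "c = 2 * c'" "n = m + 2"
    using assms by (metis evenE le_Suc_ex add.commute)
  \<comment> \<open>The entry \<open>U (1, 1)\<close> has exponent 0, so only the three entries of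
    \<open>moment\<close> remain.\<close>
  have "I_n n [a, c] [b, 0] = moment n a b c"
    by (simp add: I_n_def moment_def numeral_2_eq_2 mult.assoc)
  also have "\<dots> = dfact (m + 1) * dfact m * dfact a * dfact b * dfact c * dfact (b + c + m) /
      (dfact (b + m) * dfact (c + m) * dfact (a + b + c + m + 1))"
    unfolding eqs by (rule moment_even)
  finally have I: "I_n n [a, c] [b, 0] = \<dots>" .
  have "Phi_n n [a, c] [b, 0] =
      dfact (a + c + m) * dfact (b + m) / (dfact m ^ 2 * (dfact a * dfact c) * dfact b) * I_n n [a, c] [b, 0]"
    by (simp add: Phi_n_def numeral_2_eq_2 dfact_0 eqs(4) add.assoc)
  \<comment> \<open>The normalisation cancels \<open>dfact a\<close>, \<open>dfact b\<close>,
    \<open>dfact c\<close>, \<open>dfact (b + m)\<close> and one of the two factors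
    \<open>dfact m\<close>.\<close>
  also have "\<dots> = dfact (m + 1) / dfact m *
      (dfact (a + c + m) * dfact (b + c + m) / (dfact (c + m) * dfact (a + b + c + m + 1)))"
    unfolding I by (simp add: field_simps power2_eq_square)
  finally show ?thesis by (simp add: eqs(4))
qed

end
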